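(* Let $n$ be a non-negative integer. Then $s(n)=t(n)+2$ if $n\ge 8$, and $$s(n)=\begin{cases}\omega(n) & \text{if } 0\le n\le 7,\\ \omega(n)+n-6 & \text{if } 8\le n\le 12,\\ \omega(n)+\lfloor n/2\rfloor+1 & \text{if } 13\le n\le 28,\\ \lfloor n/2\rfloor+1 & \text{if } n\ge 29.\end{cases}$$
   Context: A set of lines through the origin in a Euclidean space is equiangular if any two distinct lines of the set form the same angle. For a set $U$ of lines, $\langle U\rangle_{\mathbb R}$ is the smallest $\mathbb R$-linear subspace containing $U$. Two sets $U,U'$ of equiangular lines are equivalent if there is an $\mathbb R$-linear map $f:\langle U\rangle_{\mathbb R}\to\langle U'\rangle_{\mathbb R}$ preserving inner products with $f(U)=U'$. All counts are up to equivalence. The empty set is regarded as the set of equiangular lines of cardinality $0$, and a single line counts as a set of equiangular lines (with any common angle). $s(n)$ is the number of sets of $n$ equiangular lines with common angle $\arccos(1/3)$ (in Euclidean spaces of arbitrary dimension). $t(n)$ is the number of such sets $U$ with $\dim\langle U\rangle_{\mathbb R}<n$. $\omega(n)$ is the number of sets of $n$ equiangular lines with common angle $\arccos(1/3)$ in dimension $7$, i.e. contained in $\mathbb R^7$ (equivalently, $\dim\langle U\rangle_{\mathbb R}\le 7$). Equivalently, in terms of Seidel matrices (real symmetric matrices with zero diagonal and off-diagonal entries $\pm1$), considered up to switching equivalence ($S\sim S'$ iff $P^\top SP=S'$ for a signed permutation matrix $P$): $s(n)$ is the number of switching classes of Seidel matrices of order $n$ with largest eigenvalue at most $3$; $t(n)$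 is the number of those with largest eigenvalue equal to $3$; and $\omega(n)$ is the number of those with largest eigenvalue at most $3$ and $\operatorname{rank}(3I-S)\le 7$ (for $n=0$ the empty matrix gives $s(0)=\omega(0)=1$, $t(0)=0$). *)

theory Defs
  imports "HOL-Analysis.Analysis"
begin

section \<open>The Euclidean spaces of all finite dimensions inside one inner product space\<close>

text \<open>
  Counting equiangular lines in Euclidean spaces of arbitrary dimension, up to linear isometry
  of their spans, requires all these spaces to live in one type. We use the space of finitely
  supported real sequences with the standard inner product. The space of dimension \<open>d\<close> is the
  coordinate subspace of the sequences supported on the first \<open>d\<close> indices.
\<close>

typedef fseq = "{x :: nat \<Rightarrow> real. finite {i. x i \<noteq> 0}}"
  morphisms coord Abs_fseq
  by (rule exI[of _ "\<lambda>_. 0"]) simp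

setup_lifting type_definition_fseq

instantiation fseq :: real_vector
begin

lift_definition zero_fseq :: fseq is "\<lambda>_. 0" by simp

lift_definition plus_fseq :: "fseq \<Rightarrow> fseq \<Rightarrow> fseq" is "\<lambda>x y i. x i + y i"
  subgoal for x y
    by (rule finite_subset[of _ "{i. x i \<noteq> 0} \<union> {i. y i \<noteq> 0}"]) auto
  done

lift_definition uminus_fseq :: "fseq \<Rightarrow> fseq" is "\<lambda>x i. - x i" by simp

lift_definition minus_fseq :: "fseq \<Rightarrow> fseq \<Rightarrow> fseq" is "\<lambda>x y i. x i - y i"
  subgoal for x y
    by (rule finite_subset[of _ "{i. x i \<noteq> 0} \<union> {i. y i \<noteq> 0}"]) auto
  done

lift_definition scaleR_fseq :: "real \<Rightarrow> fseq \<Rightarrow> fseq" is "\<lambda>c x i. c * x i"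
  by (rule finite_subset) auto

instance
  by standard (transfer; simp add: fun_eq_iff algebra_simps)+

end

lemma finite_coord: "finite {i. coord x i \<noteq> 0}"
  using coord[of x] by simp

instantiation fseq :: real_inner
begin

definition inner_fseq :: "fseq \<Rightarrow> fseq \<Rightarrow> real"
  where "inner_fseq x y = (\<Sum>i | coord x i \<noteq> 0. coord x i * coord y i)"

definition norm_fseq :: "fseq \<Rightarrow> real"
  where "norm_fseq x = sqrt (inner x x)"

definition sgn_fseq :: "fseq \<Rightarrow> fseq"
  where "sgn_fseq x = x /\<^sub>R norm x"

definition dist_fseq :: "fseq \<Rightarrow> fseq \<Rightarrow> real"
  where "dist_fseq x y = norm (x - y)"

definition uniformity_fseq :: "(fseq \<times> fseq) filter"
  where "uniformity_fseq = (INF e\<in>{0<..}. principal {(x, y). dist x y < e})"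

definition open_fseq :: "fseq set \<Rightarrow> bool"
  where "open_fseq U \<longleftrightarrow> (\<forall>x\<in>U. eventually (\<lambda>(x', y). x' = x \<longrightarrow> y \<in> U) uniformity)"

lemma inner_fseq_superset:
  assumes "finite A" "{i. coord x i \<noteq> 0} \<subseteq> A"
  shows "inner x y = (\<Sum>i\<in>A. coord x i * coord y i)"
  unfolding inner_fseq_def by (rule sum.mono_neutral_left) (use assms in auto)

instance
proof
  fix x y z :: fseq and r :: real
  let ?A = "{i. coord x i \<noteq> 0} \<union> {i. coord y i \<noteq> 0}"
  have fin: "finite ?A" using finite_coord by blast
  have x: "inner x w = (\<Sum>i\<in>?A. coord x i * coord w i)" for w
    by (rule inner_fseq_superset[OF fin]) auto
  have y: "inner y w = (\<Sum>i\<in>?A. coord y i * coord w i)" for w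
    by (rule inner_fseq_superset[OF fin]) auto
  have xy: "inner (x + y) w = (\<Sum>i\<in>?A. coord (x + y) i * coord w i)" for w
    by (rule inner_fseq_superset[OF fin]) (auto simp: plus_fseq.rep_eq)
  have rx: "inner (r *\<^sub>R x) w = (\<Sum>i\<in>?A. coord (r *\<^sub>R x) i * coord w i)" for w
    by (rule inner_fseq_superset[OF fin]) (auto simp: scaleR_fseq.rep_eq)
  show "inner x y = inner y x"
    by (simp add: x y mult.commute)
  show "inner (x + y) z = inner x z + inner y z"
    by (simp add: x y xy plus_fseq.rep_eq algebra_simps sum.distrib)
  show "inner (r *\<^sub>R x) y = r * inner x y"
    by (simp add: x rx scaleR_fseq.rep_eq sum_distrib_left mult.assoc)
  show "0 \<le> inner x x"
    unfolding inner_fseq_def by (rule sum_nonneg) simp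
  show "inner x x = 0 \<longleftrightarrow> x = 0"
  proof
    assume "inner x x = 0"
    then have "\<forall>i\<in>{i. coord x i \<noteq> 0}. coord x i * coord x i = 0"
      unfolding inner_fseq_def by (subst (asm) sum_nonneg_eq_0_iff) (auto simp: finite_coord)
    then have "coord x = coord 0" by (auto simp: fun_eq_iff zero_fseq.rep_eq)
    then show "x = 0" by (simp add: coord_inject)
  qed (simp add: inner_fseq_def zero_fseq.rep_eq)
qed (simp_all add: norm_fseq_def sgn_fseq_def dist_fseq_def uniformity_fseq_def open_fseq_def)

end

definition euclidean :: "nat \<Rightarrow> fseq set"
  where "euclidean d = {x. \<forall>i\<ge>d. coord x i = 0}"


section \<open>Sets of equiangular lines\<close>

definition is_line :: "'a::real_inner set \<Rightarrow> bool"
  where "is_line l \<longleftrightarrow> (\<exists>v. v \<noteq> 0 \<and> l = span {v})"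

text \<open>
  The angle between two lines is the non-obtuse one, hence the absolute value. It does not depend
  on the spanning vectors \<open>u\<close> and \<open>v\<close>.
\<close>

definition lines_at_angle :: "real \<Rightarrow> 'a::real_inner set \<Rightarrow> 'a set \<Rightarrow> bool"
  where "lines_at_angle \<theta> l m \<longleftrightarrow>
    (\<forall>u\<in>l. \<forall>v\<in>m. u \<noteq> 0 \<longrightarrow> v \<noteq> 0 \<longrightarrow> arccos (\<bar>inner u v\<bar> / (norm u * norm v)) = \<theta>)"

text \<open>The empty set and singletons are equiangular with every common angle.\<close>

definition equiangular :: "real \<Rightarrow> 'a::real_inner set set \<Rightarrow> bool"
  where "equiangular \<theta> U \<longleftrightarrow>
    (\<forall>l\<in>U. is_line l) \<and> (\<forall>l\<in>U. \<forall>m\<in>U. l \<noteq> m \<longrightarrow> lines_at_angle \<theta> l m)"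

text \<open>
  The map \<open>f\<close> is only constrained on the span of \<open>U\<close>, i.e. it stands for a linear map
  between the two spans.
\<close>

definition lines_equiv :: "'a::real_inner set set \<Rightarrow> 'b::real_inner set set \<Rightarrow> bool"
  where "lines_equiv U U' \<longleftrightarrow> (\<exists>f.
    f ` span (\<Union>U) \<subseteq> span (\<Union>U') \<and>
    (\<forall>x\<in>span (\<Union>U). \<forall>y\<in>span (\<Union>U). f (x + y) = f x + f y) \<and>
    (\<forall>c. \<forall>x\<in>span (\<Union>U). f (c *\<^sub>R x) = c *\<^sub>R f x) \<and>
    (\<forall>x\<in>span (\<Union>U). \<forall>y\<in>span (\<Union>U). inner (f x) (f y) = inner x y) \<and>
    (\<lambda>l. f ` l) ` U = U')"

definition num_classes :: "'a::real_inner set set set \<Rightarrow> nat"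
  where "num_classes X = card (X // {(U, U'). U \<in> X \<and> U' \<in> X \<and> lines_equiv U U'})"


section \<open>The counting functions\<close>

definition line_sets :: "nat \<Rightarrow> nat \<Rightarrow> fseq set set set"
  where "line_sets d n =
    {U. finite U \<and> card U = n \<and> (\<forall>l\<in>U. l \<subseteq> euclidean d) \<and> equiangular (arccos (1 / 3)) U}"

definition s_num :: "nat \<Rightarrow> nat"
  where "s_num n = num_classes (\<Union>d. line_sets d n)"

definition t_num :: "nat \<Rightarrow> nat"
  where "t_num n = num_classes {U \<in> (\<Union>d. line_sets d n). dim (span (\<Union>U)) < n}"

definition omega_num :: "nat \<Rightarrow> nat"
  where "omega_num n = num_classes (line_sets 7 n)"

end

theory Submission
  imports Defs
begin

text \<open>
  Choose on every line a spanning vector of square length \<open>3\<close>. Then a set of lines at angle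
  \<open>arccos (1/3)\<close> becomes a family of vectors whose mutual inner products are \<open>1\<close> and \<open>-1\<close>, and two
  sets are equivalent iff they have such families with the same Gram matrix. The set of all sign
  patterns of the families of a line set, its switching class, is therefore a complete invariant.
  It takes finitely many values for fixed \<open>n\<close> and determines the dimension of the span, so the
  counts are cardinalities of finite sets of switching classes, and they may be split along
  conditions on the dimension (\<open>num_classes_eq_card_switching_classes\<close>, \<open>s_num_split\<close>).
  In particular \<open>omega_num n\<close> counts the classes whose span has dimension at most \<open>7\<close>.

  The geometric core (\<open>norm3_system_matching_or_small\<close>) is that a line set either has spanning
  vectors for which the pairs with inner product \<open>-1\<close> form a matching, or spans dimension at most
  \<open>7\<close> and has at most \<open>28\<close> lines. If no three spanning vectors have all mutual inner products
  \<open>-1\<close>, then all inner products can be made \<open>1\<close>. Otherwise let \<open>p\<close>, \<open>q\<close>, \<open>r\<close> be such vectors. Together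
  with \<open>s = - (p + q + r)\<close> they are the vertices of a regular tetrahedron, and the midpoints
  \<open>h\<^sub>1\<close>, \<open>h\<^sub>2\<close>, \<open>h\<^sub>3\<close> of three of its edges are orthonormal. Any further vector has inner product \<open>1\<close> with
  two vertices and \<open>-1\<close> with the other two, hence is \<open>\<plusminus> h\<^sub>i + u\<close> for some \<open>i\<close>, with a root \<open>u\<close> (square
  length \<open>2\<close>) orthogonal to the \<open>h\<^sub>j\<close>. These are the three pillars of Lemmens and Seidel.

  If only the pillar of \<open>h\<close> occurs, then all vectors, the vertices included, are \<open>\<plusminus> h + u\<close> with a root \<open>u\<close> orthogonal to \<open>h\<close>; those of the form \<open>h + u\<close> are a
  system of representatives, and two of them have inner product \<open>-1\<close> only when their roots are
  opposite, which gives a matching. If two pillars occur, take a root from each. With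
  suitable signs they span the root system \<open>A\<^sub>2\<close>, and modulo the five-dimensional space spanned by the \<open>h\<^sub>i\<close>
  and these roots every vector becomes \<open>0\<close> or, up to sign, one of the vectors of a set of vectors
  of square length \<open>4/3\<close> with mutual inner products \<open>-2/3\<close>. Such a set has at most three elements
  and spans at most two dimensions. This bounds the dimension by \<open>5 + 2\<close> and the number of lines by
  \<open>4 + 3 * (2 + 6)\<close>.

  A matching configuration is determined by \<open>n\<close> and the number \<open>a\<close> of edges. It spans dimension \<open>n\<close>
  if \<open>a = 0\<close> and \<open>n + 1 - a\<close> otherwise, and different \<open>a\<close> are inequivalent for \<open>n \<ge> 3\<close>. Hence, for \<open>n \<ge> 8\<close>,
  the classes of dimension more than \<open>7\<close> correspond to \<open>0 \<le> a \<le> min (n div 2) (n - 7)\<close>, and the classes of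
  dimension \<open>n\<close> to \<open>a = 0\<close> and \<open>a = 1\<close>. For \<open>n \<ge> 29\<close> no class has dimension at most \<open>7\<close>.
\<close>


section \<open>Symmetric systems of vectors of square length three\<close>

text \<open>
  The set of all vectors of square length \<open>3\<close> on the lines of a line set. Keeping both vectors of each
  line makes the choice of signs disappear from the geometric arguments.
\<close>

definition norm3_system :: "'a::real_inner set \<Rightarrow> bool"
  where "norm3_system W \<longleftrightarrow> (\<forall>x\<in>W. - x \<in> W \<and> x \<bullet> x = 3) \<and>
    (\<forall>x\<in>W. \<forall>y\<in>W. x \<bullet> y \<in> {3, 1, -1, -3})"

lemma eq_if_inner_eq:
  fixes x y :: "'a::real_inner"
  assumes "x \<bullet> x = c" "y \<bullet> y = c" "x \<bullet> y = c"
  shows "x = y"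
proof -
  have "(x - y) \<bullet> (x - y) = 0"
    using assms by (simp add: inner_diff inner_commute)
  then show ?thesis by simp
qed

lemma eq_minus_if_inner_eq_minus:
  fixes x y :: "'a::real_inner"
  assumes "x \<bullet> x = c" "y \<bullet> y = c" "x \<bullet> y = - c"
  shows "x = - y"
  using eq_if_inner_eq[of x c "- y"] assms by simp

lemma inner_bound_if_same_norm:
  fixes x y :: "'a::real_inner"
  assumes "x \<bullet> x = c" "y \<bullet> y = c"
  shows "x \<bullet> y \<le> c" "- c \<le> x \<bullet> y"
proof -
  have "0 \<le> (x - y) \<bullet> (x - y)" "0 \<le> (x + y) \<bullet> (x + y)"
    by simp_all
  then show "x \<bullet> y \<le> c" "- c \<le> x \<bullet> y"
    using assms by (simp_all add: inner_diff inner_add inner_commute)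
qed


section \<open>The three pillars\<close>

definition orthonormal3 :: "'a::real_inner \<Rightarrow> 'a \<Rightarrow> 'a \<Rightarrow> bool"
  where "orthonormal3 h1 h2 h3 \<longleftrightarrow> h1 \<bullet> h1 = 1 \<and> h2 \<bullet> h2 = 1 \<and> h3 \<bullet> h3 = 1 \<and>
    h1 \<bullet> h2 = 0 \<and> h1 \<bullet> h3 = 0 \<and> h2 \<bullet> h3 = 0"

text \<open>
  For orthonormal \<open>h1\<close>, \<open>h2\<close>, \<open>h3\<close> these are the vertices of a regular tetrahedron centred at the origin:
  they have square length \<open>3\<close> and mutual inner products \<open>-1\<close>.
\<close>

definition tetrahedron :: "'a::real_inner \<Rightarrow> 'a \<Rightarrow> 'a \<Rightarrow> 'a set"
  where "tetrahedron h1 h2 h3 = {h1 + h2 + h3, h1 - h2 - h3, - h1 + h2 - h3, - h1 - h2 + h3}"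

definition on_axis :: "'a::real_inner \<Rightarrow> 'a \<Rightarrow> 'a \<Rightarrow> 'a \<Rightarrow> bool"
  where "on_axis h1 h2 h3 x \<longleftrightarrow> \<bar>x \<bullet> h1\<bar> = 1 \<and> x \<bullet> h2 = 0 \<and> x \<bullet> h3 = 0"

definition pillar_decomposition :: "'a::real_inner set \<Rightarrow> 'a \<Rightarrow> 'a \<Rightarrow> 'a \<Rightarrow> bool"
  where "pillar_decomposition W h1 h2 h3 \<longleftrightarrow> orthonormal3 h1 h2 h3 \<and>
    (\<forall>x\<in>W. x \<in> tetrahedron h1 h2 h3 \<or> - x \<in> tetrahedron h1 h2 h3 \<or>
      on_axis h1 h2 h3 x \<or> on_axis h2 h3 h1 x \<or> on_axis h3 h1 h2 x)"

lemma pillar_decomposition_rotate: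
  "pillar_decomposition W h1 h2 h3 \<Longrightarrow> pillar_decomposition W h2 h3 h1"
  unfolding pillar_decomposition_def orthonormal3_def tetrahedron_def
  by (auto simp: inner_commute algebra_simps)

text \<open>
  The fourth vertex \<open>s = - (p + q + r)\<close> again has square length \<open>3\<close>. The inner products of
  a vector \<open>x\<close> of the system with the four vertices sum to zero. If one of them is \<open>3\<close> or \<open>-3\<close>, then \<open>x\<close> is
  a vertex up to sign. Otherwise two of them are \<open>1\<close> and two are \<open>-1\<close>; the three ways to split
  four vertices into two pairs correspond to the three axes.
\<close>

lemma negative_triple_gives_pillars:
  fixes W :: "'a::real_inner set"
  assumes W: "norm3_system W" and pW: "p \<in> W" and qW: "q \<in> W" and rW: "r \<in> W"
    and pq: "p \<bullet> q = -1" and pr: "p \<bullet> r = -1" and qr: "q \<bullet> r = -1"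
  shows "\<exists>h1 h2 h3. pillar_decomposition W h1 h2 h3"
proof -
  define h1 where "h1 = (1/2) *\<^sub>R (p + q)"
  define h2 where "h2 = (1/2) *\<^sub>R (p + r)"
  define h3 where "h3 = - (1/2) *\<^sub>R (q + r)"
  define s where "s = - (p + q + r)"
  have n: "p \<bullet> p = 3" "q \<bullet> q = 3" "r \<bullet> r = 3"
    using W pW qW rW by (auto simp: norm3_system_def)
  have sym: "q \<bullet> p = -1" "r \<bullet> p = -1" "r \<bullet> q = -1"
    using pq pr qr by (simp_all add: inner_commute)
  have ss: "s \<bullet> s = 3"
    using n pq pr qr sym by (simp add: s_def inner_add inner_diff)
  have o: "orthonormal3 h1 h2 h3"
    using n pq pr qr sym
    by (simp add: orthonormal3_def h1_def h2_def h3_def inner_add inner_diff algebra_simps)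
  have "h1 + h2 + h3 = p" "h1 - h2 - h3 = q" "- h1 + h2 - h3 = r" "- h1 - h2 + h3 = s"
    by (simp_all add: h1_def h2_def h3_def s_def algebra_simps flip: scaleR_add_left)
  then have t: "tetrahedron h1 h2 h3 = {p, q, r, s}"
    by (simp add: tetrahedron_def)
  have "x \<in> {p, q, r, s} \<or> - x \<in> {p, q, r, s} \<or>
      on_axis h1 h2 h3 x \<or> on_axis h2 h3 h1 x \<or> on_axis h3 h1 h2 x" if xW: "x \<in> W" for x
  proof (cases "x \<in> {p, q, r, s} \<or> - x \<in> {p, q, r, s}")
    case False
    have xx: "x \<bullet> x = 3" using W xW by (auto simp: norm3_system_def)
    have ne: "x \<bullet> y \<noteq> 3" "x \<bullet> y \<noteq> - 3" if "y \<in> {p, q, r, s}" for y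
    proof -
      have "y \<bullet> y = 3" using that n ss by auto
      then show "x \<bullet> y \<noteq> 3" "x \<bullet> y \<noteq> - 3"
        using eq_if_inner_eq[OF xx, of y] eq_minus_if_inner_eq_minus[OF xx, of y] False that
        by (auto simp: equation_minus_iff)
    qed
    have "x \<bullet> y \<in> {3, 1, -1, -3}" if "y \<in> {p, q, r}" for y
      using W xW pW qW rW that by (auto simp: norm3_system_def)
    then have "x \<bullet> p \<in> {1, -1}" "x \<bullet> q \<in> {1, -1}" "x \<bullet> r \<in> {1, -1}"
      using ne by auto
    moreover have "x \<bullet> s = - (x \<bullet> p + x \<bullet> q + x \<bullet> r)"
      by (simp add: s_def inner_add_right inner_diff_right)
    ultimately show ?thesis
      using ne[of s]
      by (auto simp: on_axis_def h1_def h2_def h3_def inner_add_right)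
  qed auto
  then show ?thesis
    using o t unfolding pillar_decomposition_def by metis
qed

text \<open>
  The two bounds are kept as covers by finite sets: \<open>B\<close> bounds the dimension of the span, and \<open>F\<close>,
  which covers \<open>W\<close> up to sign, bounds the number of lines.
\<close>

definition small_system :: "'a::real_inner set \<Rightarrow> bool"
  where "small_system W \<longleftrightarrow> (\<exists>B. finite B \<and> card B \<le> 7 \<and> W \<subseteq> span B) \<and>
    (\<exists>F. finite F \<and> card F \<le> 28 \<and> (\<forall>x\<in>W. x \<in> F \<or> - x \<in> F))"

text \<open>
  The sum of three distinct elements has square length \<open>3 * 4/3 - 6 * 2/3 = 0\<close>.
\<close>

lemma residues_from_two:
  fixes R :: "'a::real_inner set"
  assumes n: "\<And>x. x \<in> R \<Longrightarrow> x \<bullet> x = 4/3"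
    and ip: "\<And>x y. x \<in> R \<Longrightarrow> y \<in> R \<Longrightarrow> x \<noteq> y \<Longrightarrow> x \<bullet> y = - 2/3"
  shows "\<exists>a b. R \<subseteq> {a, b, - a - b}"
proof (cases "\<exists>a\<in>R. \<exists>b\<in>R. a \<noteq> b")
  case True
  then obtain a b where ab: "a \<in> R" "b \<in> R" "a \<noteq> b" by blast
  have "c = - a - b" if c: "c \<in> R" "c \<noteq> a" "c \<noteq> b" for c
  proof -
    have "(a + b + c) \<bullet> (a + b + c) = 0"
      using n[of a] n[of b] n[of c] ip[of a b] ip[of a c] ip[of b c] ab c
      by (simp add: inner_add inner_commute)
    then have "a + b + c = 0" by simp
    then show ?thesis by (simp add: algebra_simps eq_neg_iff_add_eq_0)
  qed
  then show ?thesis by (intro exI[of _ a] exI[of _ b]) auto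
next
  case False
  then show ?thesis by blast
qed



section \<open>Two occupied pillars\<close>

text \<open>
  The vectors \<open>a\<close> and \<open>b\<close> span the root system \<open>A\<^sub>2\<close>, and \<open>(2 b - a) / 3\<close> is the element of their
  span that has inner products \<open>0\<close> with \<open>a\<close> and \<open>1\<close> with \<open>b\<close>; its square length is \<open>2/3\<close>. It is therefore
  the orthogonal projection of \<open>\<plusminus> u\<close> when \<open>u\<close> is orthogonal to \<open>a\<close>, and the remaining part \<open>\<rho>\<close> has square
  length \<open>2 - 2/3\<close>. If \<open>u\<close> is not orthogonal to \<open>a\<close>, the equality case of Cauchy-Schwarz applies.
\<close>

lemma A2_coset:
  fixes a b u :: "'a::real_inner"
  assumes aa: "a \<bullet> a = 2" and bb: "b \<bullet> b = 2" and ab: "a \<bullet> b = 1" and uu: "u \<bullet> u = 2"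
    and ua: "u \<bullet> a \<in> {-2, 0, 2}" and ub: "\<bar>u \<bullet> b\<bar> = 1"
  shows "u = a \<or> u = - a \<or> (\<exists>\<sigma> \<rho>. \<bar>\<sigma>\<bar> = 1 \<and> u = \<sigma> *\<^sub>R ((1/3) *\<^sub>R (2 *\<^sub>R b - a) + \<rho>) \<and>
    \<rho> \<bullet> \<rho> = 4/3 \<and> \<rho> \<bullet> a = 0 \<and> \<rho> \<bullet> b = 0)"
proof -
  consider "u \<bullet> a = 2" | "u \<bullet> a = -2" | "u \<bullet> a = 0" using ua by auto
  then show ?thesis
  proof cases
    case 1
    then show ?thesis using eq_if_inner_eq[OF uu aa] by simp
  next
    case 2
    then show ?thesis using eq_minus_if_inner_eq_minus[OF uu aa] by simp
  next
    case 3
    define \<sigma> where "\<sigma> = u \<bullet> b"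
    define d where "d = (1/3) *\<^sub>R (2 *\<^sub>R b - a)"
    have s: "\<bar>\<sigma>\<bar> = 1" "\<sigma> * \<sigma> = 1" using ub by (auto simp: \<sigma>_def abs_if split: if_splits)
    have sym: "a \<bullet> u = 0" "b \<bullet> u = \<sigma>" "b \<bullet> a = 1" "u \<bullet> b = \<sigma>"
      using 3 ab by (simp_all add: \<sigma>_def inner_commute)
    let ?\<rho> = "\<sigma> *\<^sub>R u - d"
    have d: "d \<bullet> a = 0" "d \<bullet> b = 1" "d \<bullet> d = 2/3" "d \<bullet> u = 2/3 * \<sigma>" "u \<bullet> d = 2/3 * \<sigma>"
      using aa bb ab sym 3 by (simp_all add: d_def inner_diff inner_add)
    have "u = \<sigma> *\<^sub>R (d + ?\<rho>)" using s by simp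
    moreover have "?\<rho> \<bullet> ?\<rho> = 4/3" "?\<rho> \<bullet> a = 0" "?\<rho> \<bullet> b = 0"
      using d s sym 3 uu by (simp_all add: inner_diff algebra_simps)
    ultimately show ?thesis using s unfolding d_def by blast
  qed
qed

text \<open>
  A root from each of two pillars gives \<open>a\<close> and \<open>b\<close> as in \<open>A2_coset\<close>. That lemma also
  applies to the pairs \<open>(b, a)\<close> and \<open>(b - a, - a)\<close>, and one of the three pairs fits each pillar. So every vector
  of the system is, up to sign, a vertex of the tetrahedron or \<open>h \<plusminus> e\<close> or \<open>h \<plusminus> (d + \<rho>)\<close>. Here
  \<open>(h, d, e)\<close> is one of three triples and \<open>\<rho>\<close> is orthogonal to all their vectors; the vectors \<open>\<rho>\<close> that
  occur are subject to \<open>residues_from_two\<close>.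
\<close>

lemma two_pillars_small:
  fixes W :: "'a::real_inner set"
  assumes W: "norm3_system W" and pd: "pillar_decomposition W h1 h2 h3"
    and x0: "x0 \<in> W" "on_axis h1 h2 h3 x0" and y0: "y0 \<in> W" "on_axis h2 h3 h1 y0"
  shows "small_system W"
proof -
  have neg: "- x \<in> W" if "x \<in> W" for x using W that by (auto simp: norm3_system_def)
  have nrm: "x \<bullet> x = 3" if "x \<in> W" for x using W that by (auto simp: norm3_system_def)
  have vals: "x \<bullet> y \<in> {3, 1, -1, -3}" if "x \<in> W" "y \<in> W" for x y
    using W that by (auto simp: norm3_system_def)
  have h: "h1 \<bullet> h1 = 1" "h2 \<bullet> h2 = 1" "h3 \<bullet> h3 = 1" "h1 \<bullet> h2 = 0" "h1 \<bullet> h3 = 0" "h2 \<bullet> h3 = 0"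
    "h2 \<bullet> h1 = 0" "h3 \<bullet> h1 = 0" "h3 \<bullet> h2 = 0"
    using pd by (auto simp: pillar_decomposition_def orthonormal3_def inner_commute)
  obtain x where x: "x \<in> W" "x \<bullet> h1 = 1" "x \<bullet> h2 = 0" "x \<bullet> h3 = 0"
    using x0 neg[of x0] unfolding on_axis_def
    by (cases "x0 \<bullet> h1 = 1") (force simp: abs_if split: if_splits)+
  obtain y where y: "y \<in> W" "y \<bullet> h1 = 0" "y \<bullet> h2 = 1" "y \<bullet> h3 = 0"
    using y0 neg[of y0] unfolding on_axis_def
    by (cases "y0 \<bullet> h2 = 1") (force simp: abs_if split: if_splits)+
  have symxy: "h1 \<bullet> x = 1" "h2 \<bullet> x = 0" "h3 \<bullet> x = 0" "h1 \<bullet> y = 0" "h2 \<bullet> y = 1" "h3 \<bullet> y = 0"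
    using x y by (simp_all add: inner_commute)
  define \<epsilon> where "\<epsilon> = x \<bullet> y"
  define a where "a = x - h1"
  define b where "b = \<epsilon> *\<^sub>R (y - h2)"
  have aa: "a \<bullet> a = 2"
    using nrm[OF x(1)] x symxy h by (simp add: a_def inner_diff)
  have b': "(y - h2) \<bullet> (y - h2) = 2"
    using nrm[OF y(1)] y symxy h by (simp add: inner_diff)
  have "a \<bullet> (y - h2) = \<epsilon>"
    using x y symxy h by (simp add: a_def \<epsilon>_def inner_diff)
  with inner_bound_if_same_norm[OF aa b'] vals[OF x(1) y(1)]
  have \<epsilon>: "\<epsilon> = 1 \<or> \<epsilon> = -1" by (auto simp: \<epsilon>_def)
  have bb: "b \<bullet> b = 2" and ab: "a \<bullet> b = 1"
    using \<open>a \<bullet> (y - h2) = \<epsilon>\<close> b' \<epsilon> by (auto simp: b_def inner_commute)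
  have ba: "b \<bullet> a = 1" using ab by (simp add: inner_commute)
  have ah: "a \<bullet> h1 = 0" "a \<bullet> h2 = 0" "a \<bullet> h3 = 0" "b \<bullet> h1 = 0" "b \<bullet> h2 = 0" "b \<bullet> h3 = 0"
    using x y h by (simp_all add: a_def b_def inner_diff)
  have ha: "h1 \<bullet> a = 0" "h2 \<bullet> a = 0" "h3 \<bullet> a = 0" "h1 \<bullet> b = 0" "h2 \<bullet> b = 0" "h3 \<bullet> b = 0"
    using ah by (simp_all add: inner_commute)

  \<comment> \<open>The shortest vectors of the dual lattice of \<open>A\<^sub>2\<close>, up to sign: \<open>d1 + d2 + d3 = 0\<close>, and their differences
      are the roots \<open>a = d2 - d3\<close>, \<open>b = d1 - d3\<close> and \<open>b - a = d1 - d2\<close>.\<close>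
  define d1 where "d1 = (1/3) *\<^sub>R (2 *\<^sub>R b - a)"
  define d2 where "d2 = (1/3) *\<^sub>R (2 *\<^sub>R a - b)"
  define d3 where "d3 = - (1/3) *\<^sub>R (a + b)"
  define T where "T = {(h1, d1, a), (h2, d2, b), (h3, d3, b - a)}"
  define perp where "perp \<rho> \<longleftrightarrow> \<rho> \<bullet> \<rho> = 4/3 \<and> \<rho> \<bullet> a = 0 \<and> \<rho> \<bullet> b = 0 \<and>
    \<rho> \<bullet> h1 = 0 \<and> \<rho> \<bullet> h2 = 0 \<and> \<rho> \<bullet> h3 = 0" for \<rho>
  define R where "R = {\<rho>. perp \<rho> \<and> (\<exists>(h, d, e)\<in>T. \<exists>\<sigma>. \<bar>\<sigma>\<bar> = 1 \<and> h + \<sigma> *\<^sub>R (d + \<rho>) \<in> W)}"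

  have roots: "z = h + e \<or> z = h - e \<or> (\<exists>\<sigma> \<rho>. \<bar>\<sigma>\<bar> = 1 \<and> z = h + \<sigma> *\<^sub>R (d + \<rho>) \<and> perp \<rho>)"
    if z: "z \<in> W" and zh: "z \<bullet> h = 1" "z \<bullet> h1 \<noteq> 0 \<longrightarrow> h = h1" "z \<bullet> h2 \<noteq> 0 \<longrightarrow> h = h2"
      "z \<bullet> h3 \<noteq> 0 \<longrightarrow> h = h3" and hT: "(h, d, e) \<in> T" for z h d e
  proof -
    define u where "u = z - h"
    have hh: "h \<bullet> h = 1" using hT h by (auto simp: T_def)
    have "h \<bullet> z = 1" using zh by (simp add: inner_commute)
    then have uu: "u \<bullet> u = 2" using nrm[OF z] zh hh by (simp add: u_def inner_diff)
    have u0: "u \<bullet> h1 = 0" "u \<bullet> h2 = 0" "u \<bullet> h3 = 0"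
      using zh hT h by (auto simp: u_def inner_diff T_def)
    \<comment> \<open>The inner products of \<open>z\<close> with the two chosen vectors of the system determine those of
        its root \<open>u\<close> with \<open>a\<close> and \<open>b\<close>.\<close>
    have zx: "z \<bullet> x = (if h = h1 then 1 + u \<bullet> a else u \<bullet> a)"
    proof -
      have "z \<bullet> x = (u + h) \<bullet> (a + h1)" by (simp add: u_def a_def)
      also have "\<dots> = u \<bullet> a + h \<bullet> h1"
        using hT u0 ha by (auto simp: T_def inner_add)
      finally show ?thesis using hT h by (auto simp: T_def)
    qed
    have zy: "\<epsilon> * (z \<bullet> y) = (if h = h2 then \<epsilon> + u \<bullet> b else u \<bullet> b)"
    proof -
      have "\<epsilon> * (z \<bullet> y) = (u + h) \<bullet> (\<epsilon> *\<^sub>R (y - h2) + \<epsilon> *\<^sub>R h2)" by (simp add: u_def algebra_simps)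
      also have "\<dots> = u \<bullet> b + \<epsilon> * (h \<bullet> h2)"
        using hT u0 ha by (auto simp: T_def inner_add simp flip: b_def)
      finally show ?thesis using hT h by (auto simp: T_def)
    qed
    have bnd: "\<bar>u \<bullet> a\<bar> \<le> 2" "\<bar>u \<bullet> b\<bar> \<le> 2"
      using inner_bound_if_same_norm[OF uu aa] inner_bound_if_same_norm[OF uu bb] by auto
    have ne: "h1 \<noteq> h2" "h2 \<noteq> h3" "h1 \<noteq> h3" using h by auto
    have wrap: "z = h + e \<or> z = h - e \<or> (\<exists>\<sigma> \<rho>. \<bar>\<sigma>\<bar> = 1 \<and> z = h + \<sigma> *\<^sub>R (d + \<rho>) \<and> perp \<rho>)"
      if c: "u = e \<or> u = - e \<or> (\<exists>\<sigma> \<rho>. \<bar>\<sigma>\<bar> = 1 \<and> u = \<sigma> *\<^sub>R (d + \<rho>) \<and>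
        \<rho> \<bullet> \<rho> = 4/3 \<and> \<rho> \<bullet> a = 0 \<and> \<rho> \<bullet> b = 0)"
    proof -
      have "perp \<rho>" if "\<bar>\<sigma>\<bar> = 1" "u = \<sigma> *\<^sub>R (d + \<rho>)" "\<rho> \<bullet> \<rho> = 4/3" "\<rho> \<bullet> a = 0" "\<rho> \<bullet> b = 0" for \<sigma> \<rho>
      proof -
        have dh: "d \<bullet> h1 = 0" "d \<bullet> h2 = 0" "d \<bullet> h3 = 0"
          using hT ah by (auto simp: T_def d1_def d2_def d3_def inner_diff inner_add)
        have "\<sigma> \<noteq> 0" using that by auto
        then show ?thesis using u0 that dh by (auto simp: perp_def inner_add)
      qed
      moreover have "z = h + u" by (simp add: u_def)
      ultimately show ?thesis using c by auto
    qed
    note vx = vals[OF z x(1)] and vy = vals[OF z y(1)]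
    consider "h = h1" "d = d1" "e = a" | "h = h2" "d = d2" "e = b" | "h = h3" "d = d3" "e = b - a"
      using hT by (auto simp: T_def)
    then show ?thesis
    proof cases
      case 1
      have "u \<bullet> a \<in> {-2, 0, 2}" "\<bar>u \<bullet> b\<bar> = 1"
        using vx vy zx zy 1 bnd ne \<epsilon> by auto
      then show ?thesis using A2_coset[OF aa bb ab uu] wrap 1 unfolding d1_def by blast
    next
      case 2
      have "u \<bullet> b \<in> {-2, 0, 2}" "\<bar>u \<bullet> a\<bar> = 1"
        using vx vy zx zy 2 bnd ne \<epsilon> by auto
      then show ?thesis using A2_coset[OF bb aa ba uu] wrap 2 unfolding d2_def by blast
    next
      case 3
      have ua: "\<bar>u \<bullet> a\<bar> = 1" and "\<bar>u \<bullet> b\<bar> = 1"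
        using vx vy zx zy 3 bnd ne \<epsilon> by auto
      then have "u \<bullet> (b - a) \<in> {-2, 0, 2}" "\<bar>u \<bullet> (- a)\<bar> = 1"
        by (auto simp: inner_diff abs_if split: if_splits)
      moreover have "(b - a) \<bullet> (b - a) = 2" "(- a) \<bullet> (- a) = 2" "(b - a) \<bullet> (- a) = 1"
        using aa bb ab ba by (simp_all add: inner_diff)
      moreover have "(1/3) *\<^sub>R (2 *\<^sub>R (- a) - (b - a)) = d3"
        by (simp add: d3_def algebra_simps scaleR_2)
      moreover have "\<rho> \<bullet> a = 0 \<and> \<rho> \<bullet> b = 0" if "\<rho> \<bullet> (b - a) = 0" "\<rho> \<bullet> (- a) = 0" for \<rho>
        using that by (simp add: inner_diff)
      ultimately show ?thesis using A2_coset[of "b - a" "- a" u] wrap uu 3 by metis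
    qed
  qed

  have hd: "h1 \<bullet> d1 = 0" "h1 \<bullet> d2 = 0" "h1 \<bullet> d3 = 0" "h2 \<bullet> d1 = 0" "h2 \<bullet> d2 = 0" "h2 \<bullet> d3 = 0"
    "h3 \<bullet> d1 = 0" "h3 \<bullet> d2 = 0" "h3 \<bullet> d3 = 0"
    using ha by (simp_all add: d1_def d2_def d3_def inner_diff inner_add)
  have dd: "d1 \<bullet> d1 = 2/3" "d2 \<bullet> d2 = 2/3" "d3 \<bullet> d3 = 2/3" "d1 \<bullet> d2 = - 1/3" "d1 \<bullet> d3 = - 1/3"
    "d2 \<bullet> d3 = - 1/3" "d2 \<bullet> d1 = - 1/3" "d3 \<bullet> d1 = - 1/3" "d3 \<bullet> d2 = - 1/3"
    using aa bb ab ba by (simp_all add: d1_def d2_def d3_def inner_diff inner_add)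
  have T_orth: "h \<bullet> d' = 0" if "(h, d, e) \<in> T" "(h', d', e') \<in> T" for h d e h' d' e'
    using that hd by (auto simp: T_def)
  have T_prod: "(h \<bullet> h' = 1 \<and> d \<bullet> d' = 2/3) \<or> (h \<bullet> h' = 0 \<and> d \<bullet> d' = - 1/3)"
    if "(h, d, e) \<in> T" "(h', d', e') \<in> T" for h d e h' d' e'
    using that h dd unfolding T_def by auto
  have perp_T: "\<rho> \<bullet> h = 0" "\<rho> \<bullet> d = 0" if "perp \<rho>" "(h, d, e) \<in> T" for \<rho> h d e
    using that by (auto simp: T_def perp_def d1_def d2_def d3_def inner_diff inner_add)
  have RR: "\<rho> \<bullet> \<rho>' = - 2/3" if r: "\<rho> \<in> R" "\<rho>' \<in> R" "\<rho> \<noteq> \<rho>'" for \<rho> \<rho>'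
  proof -
    obtain h d e \<sigma> where 1: "perp \<rho>" "(h, d, e) \<in> T" "\<bar>\<sigma>\<bar> = 1" "h + \<sigma> *\<^sub>R (d + \<rho>) \<in> W"
      using r by (auto simp: R_def)
    obtain h' d' e' \<sigma>' where 2: "perp \<rho>'" "(h', d', e') \<in> T" "\<bar>\<sigma>'\<bar> = 1" "h' + \<sigma>' *\<^sub>R (d' + \<rho>') \<in> W"
      using r by (auto simp: R_def)
    \<comment> \<open>This inner product is an odd integer, so \<open>\<rho> \<bullet> \<rho>'\<close> can only be \<open>4/3\<close> or \<open>-2/3\<close>
        within the Cauchy-Schwarz bounds.\<close>
    have "(h + \<sigma> *\<^sub>R (d + \<rho>)) \<bullet> (h' + \<sigma>' *\<^sub>R (d' + \<rho>')) = h \<bullet> h' + \<sigma> * \<sigma>' * (d \<bullet> d' + \<rho> \<bullet> \<rho>')"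
      using T_orth[OF 1(2) 2(2)] T_orth[OF 2(2) 1(2)] perp_T[OF 1(1) 2(2)] perp_T[OF 2(1) 1(2)]
      by (simp add: inner_add inner_commute algebra_simps)
    moreover note T_prod[OF 1(2) 2(2)]
    moreover have "\<rho> \<bullet> \<rho>' \<noteq> 4/3" "- 4/3 \<le> \<rho> \<bullet> \<rho>'" "\<rho> \<bullet> \<rho>' \<le> 4/3"
      using 1(1) 2(1) r(3) eq_if_inner_eq[of \<rho> "4/3" \<rho>'] inner_bound_if_same_norm[of \<rho> "4/3" \<rho>']
      by (auto simp: perp_def)
    ultimately show ?thesis
      using vals[OF 1(4) 2(4)] 1(3) 2(3) unfolding abs_eq_iff' by auto
  qed
  have "\<rho> \<bullet> \<rho> = 4/3" if "\<rho> \<in> R" for \<rho>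
    using that by (simp add: R_def perp_def)
  then obtain r1 r2 where R: "R \<subseteq> {r1, r2, - r1 - r2}"
    using residues_from_two[OF _ RR] by blast

  define F where "F = tetrahedron h1 h2 h3 \<union>
    (\<Union>(h, d, e)\<in>T. {h + e, h - e} \<union> (\<Union>\<rho>\<in>{r1, r2, - r1 - r2}. {h + (d + \<rho>), h - (d + \<rho>)}))"
  have axis: "z \<in> F \<or> - z \<in> F"
    if z: "z \<in> W" and zh: "\<bar>z \<bullet> h\<bar> = 1" "z \<bullet> h1 \<noteq> 0 \<longrightarrow> h = h1" "z \<bullet> h2 \<noteq> 0 \<longrightarrow> h = h2"
      "z \<bullet> h3 \<noteq> 0 \<longrightarrow> h = h3" and hT: "(h, d, e) \<in> T" for z h d e
  proof -
    have pos: "w \<in> F" if w: "w \<in> W" "w \<bullet> h = 1" "w \<bullet> h1 \<noteq> 0 \<longrightarrow> h = h1" "w \<bullet> h2 \<noteq> 0 \<longrightarrow> h = h2"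
      "w \<bullet> h3 \<noteq> 0 \<longrightarrow> h = h3" for w
    proof -
      consider "w = h + e \<or> w = h - e"
        | \<sigma> \<rho> where "\<bar>\<sigma>\<bar> = 1" "w = h + \<sigma> *\<^sub>R (d + \<rho>)" "perp \<rho>"
        using roots[OF w hT] by blast
      then show ?thesis
      proof cases
        case 1
        then show ?thesis using hT unfolding F_def by fast
      next
        case 2
        then have "\<rho> \<in> R" using w hT unfolding R_def by blast
        then have \<rho>: "\<rho> \<in> {r1, r2, - r1 - r2}" using R by blast
        have "w \<in> {h + (d + \<rho>), h - (d + \<rho>)}" using 2(1,2) by (auto simp: abs_if split: if_splits)
        then show ?thesis using hT \<rho> unfolding F_def by fast
      qed
    qed
    show ?thesis
      using pos[OF z] pos[OF neg[OF z]] zh by (auto simp: abs_if split: if_splits)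
  qed
  have cover: "z \<in> F \<or> - z \<in> F" if z: "z \<in> W" for z
  proof -
    consider "z \<in> tetrahedron h1 h2 h3 \<or> - z \<in> tetrahedron h1 h2 h3"
      | "on_axis h1 h2 h3 z" | "on_axis h2 h3 h1 z" | "on_axis h3 h1 h2 z"
      using pd z unfolding pillar_decomposition_def by blast
    then show ?thesis
    proof cases
      case 1
      then show ?thesis by (auto simp: F_def)
    next
      case 2
      then show ?thesis using axis[OF z, of h1 d1 a] by (auto simp: on_axis_def T_def)
    next
      case 3
      then show ?thesis using axis[OF z, of h2 d2 b] by (auto simp: on_axis_def T_def)
    next
      case 4
      then show ?thesis using axis[OF z, of h3 d3 "b - a"] by (auto simp: on_axis_def T_def)
    qed
  qed
  have cF: "finite F" "card F \<le> 28"
  proof -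
    have "F = set [h1 + h2 + h3, h1 - h2 - h3, - h1 + h2 - h3, - h1 - h2 + h3,
      h1 + a, h1 - a, h1 + (d1 + r1), h1 - (d1 + r1), h1 + (d1 + r2), h1 - (d1 + r2),
      h1 + (d1 + (- r1 - r2)), h1 - (d1 + (- r1 - r2)),
      h2 + b, h2 - b, h2 + (d2 + r1), h2 - (d2 + r1), h2 + (d2 + r2), h2 - (d2 + r2),
      h2 + (d2 + (- r1 - r2)), h2 - (d2 + (- r1 - r2)),
      h3 + (b - a), h3 - (b - a), h3 + (d3 + r1), h3 - (d3 + r1), h3 + (d3 + r2), h3 - (d3 + r2),
      h3 + (d3 + (- r1 - r2)), h3 - (d3 + (- r1 - r2))]" (is "F = set ?L")
      unfolding F_def T_def tetrahedron_def by (simp add: insert_commute)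
    moreover have "card (set ?L) \<le> length ?L" by (rule card_length)
    ultimately show "finite F" "card F \<le> 28" by (metis List.finite_set, simp)
  qed
  define B where "B = set [h1, h2, h3, a, b, r1, r2]"
  have cB: "finite B" "card B \<le> 7"
    using card_length[of "[h1, h2, h3, a, b, r1, r2]"] by (simp_all add: B_def)
  have "h1 \<in> span B" "h2 \<in> span B" "h3 \<in> span B" "a \<in> span B" "b \<in> span B" "r1 \<in> span B" "r2 \<in> span B"
    by (auto simp: B_def intro: span_base)
  then have FB: "f \<in> span B" if "f \<in> F" for f
    using that unfolding F_def T_def tetrahedron_def d1_def d2_def d3_def
    by (auto intro!: span_add span_diff span_neg span_scale)
  have "W \<subseteq> span B"
  proof
    fix z assume "z \<in> W"
    then show "z \<in> span B" using cover[of z] FB[of z] span_neg[OF FB[of "- z"]] by auto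
  qed
  then show ?thesis
    unfolding small_system_def using cB cF cover by blast
qed


section \<open>Matchings\<close>

text \<open>
  A choice of signs after which the graph of the negative inner products is a matching. Such a graph is
  determined up to isomorphism by its numbers of vertices and edges.
\<close>

definition matching_section :: "'a::real_inner set \<Rightarrow> 'a set \<Rightarrow> bool"
  where "matching_section W V \<longleftrightarrow> V \<subseteq> W \<and> (\<forall>x\<in>W. x \<in> V \<or> - x \<in> V) \<and>
    (\<forall>x\<in>V. \<forall>y\<in>V. x \<noteq> y \<longrightarrow> \<bar>x \<bullet> y\<bar> = 1) \<and>
    (\<forall>x\<in>V. \<forall>y\<in>V. \<forall>z\<in>V. x \<bullet> y = -1 \<longrightarrow> x \<bullet> z = -1 \<longrightarrow> y = z)"

lemma distinct_inner_in_open_half_space: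
  fixes W :: "'a::real_inner set"
  assumes W: "norm3_system W" and xy: "x \<in> W" "y \<in> W" "x \<noteq> y" and h: "x \<bullet> h > 0" "y \<bullet> h > 0"
  shows "\<bar>x \<bullet> y\<bar> = 1"
proof -
  have n: "x \<bullet> x = 3" "y \<bullet> y = 3" "x \<bullet> y \<in> {3, 1, -1, -3}"
    using W xy by (auto simp: norm3_system_def)
  have "x \<bullet> y \<noteq> 3" using eq_if_inner_eq[OF n(1,2)] xy by blast
  moreover have "x \<bullet> y \<noteq> - 3" using eq_minus_if_inner_eq_minus[OF n(1,2)] h by auto
  ultimately show ?thesis using n by auto
qed

text \<open>
  If \<open>x \<bullet> h = y \<bullet> h = 1\<close> and \<open>x \<bullet> y = -1\<close>, then \<open>x + y - 2 h\<close> has square length \<open>0\<close>, so the only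
  possible partner of \<open>x\<close> is its reflection \<open>2 h - x\<close>.
\<close>

lemma one_pillar_matching:
  fixes W :: "'a::real_inner set"
  assumes W: "norm3_system W" and hh: "h \<bullet> h = 1" and h: "\<And>x. x \<in> W \<Longrightarrow> \<bar>x \<bullet> h\<bar> = 1"
  shows "matching_section W {x\<in>W. x \<bullet> h > 0}"
proof -
  have mate: "y = 2 *\<^sub>R h - x" if "x \<in> W" "x \<bullet> h > 0" "y \<in> W" "y \<bullet> h > 0" "x \<bullet> y = -1" for x y
  proof -
    have 1: "x \<bullet> h = 1" "y \<bullet> h = 1" "h \<bullet> x = 1" "h \<bullet> y = 1" "x \<bullet> x = 3" "y \<bullet> y = 3" "y \<bullet> x = -1"
      using h[of x] h[of y] that W by (auto simp: norm3_system_def inner_commute)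
    have "(x + y - 2 *\<^sub>R h) \<bullet> (x + y - 2 *\<^sub>R h) = 0"
      using that 1 hh by (simp add: inner_diff inner_add)
    then have "x + y - 2 *\<^sub>R h = 0" by simp
    then show ?thesis by (simp add: algebra_simps)
  qed
  have "- x \<in> W \<and> 0 < (- x) \<bullet> h" if "x \<in> W" "\<not> 0 < x \<bullet> h" for x
    using W h[of x] that by (auto simp: norm3_system_def)
  moreover have "y = z" if "x \<in> W" "x \<bullet> h > 0" "y \<in> W" "y \<bullet> h > 0" "x \<bullet> y = -1"
    "z \<in> W" "z \<bullet> h > 0" "x \<bullet> z = -1" for x y z
    using mate[of x y] mate[of x z] that by simp
  ultimately show ?thesis
    using distinct_inner_in_open_half_space[OF W] by (simp add: matching_section_def) blast
qed

text \<open>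
  Take the representatives that have positive inner product with a fixed \<open>z\<close> of the system. Two of
  them cannot have inner product \<open>-1\<close>, since together with \<open>- z\<close> they would form a
  negative triple; the matching has no edges.
\<close>

lemma no_negative_triple_matching:
  fixes W :: "'a::real_inner set"
  assumes W: "norm3_system W"
    and no: "\<And>p q r. p \<in> W \<Longrightarrow> q \<in> W \<Longrightarrow> r \<in> W \<Longrightarrow> p \<bullet> q = -1 \<Longrightarrow> p \<bullet> r = -1 \<Longrightarrow> q \<bullet> r = -1 \<Longrightarrow> False"
  shows "\<exists>V. matching_section W V"
proof (cases "W = {}")
  case True
  then show ?thesis by (auto simp: matching_section_def)
next
  case False
  then obtain z where z: "z \<in> W" by blast
  let ?V = "{x\<in>W. x \<bullet> z > 0}"
  have dist: "\<bar>x \<bullet> y\<bar> = 1" if "x \<in> ?V" "y \<in> ?V" "x \<noteq> y" for x y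
    using distinct_inner_in_open_half_space[OF W] that by blast
  have pos: "x \<bullet> y \<noteq> -1" if "x \<in> ?V" "y \<in> ?V" for x y
  proof
    assume xy: "x \<bullet> y = -1"
    have "z \<bullet> z = 3" "z \<in> ?V" "x \<bullet> x = 3" "y \<bullet> y = 3" using W z that by (auto simp: norm3_system_def)
    then have "x \<noteq> z" "y \<noteq> z" using xy that by (auto simp: inner_commute)
    then have "x \<bullet> z = 1" "y \<bullet> z = 1"
      using dist[OF that(1) \<open>z \<in> ?V\<close>] dist[OF that(2) \<open>z \<in> ?V\<close>] that by auto
    then show False using no[of x y "- z"] xy that z W by (auto simp: norm3_system_def)
  qed
  have "- x \<in> W \<and> 0 < (- x) \<bullet> z" if x: "x \<in> W" "\<not> 0 < x \<bullet> z" for x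
  proof -
    have "x \<bullet> z \<in> {3, 1, -1, -3}" "- x \<in> W"
      using W x z unfolding norm3_system_def by blast+
    then show ?thesis using x by auto
  qed
  then have "matching_section W ?V"
    using pos dist by (simp add: matching_section_def) blast
  then show ?thesis by blast
qed

text \<open>
  If none of the three axes \<open>h\<close> satisfies \<open>\<bar>x \<bullet> h\<bar> = 1\<close> for all \<open>x\<close>, then for each pillar
  there is a vector in one of the other two, so at least two pillars are occupied.
\<close>

theorem norm3_system_matching_or_small:
  fixes W :: "'a::real_inner set"
  assumes W: "norm3_system W"
  shows "(\<exists>V. matching_section W V) \<or> small_system W"
proof (cases "\<exists>p\<in>W. \<exists>q\<in>W. \<exists>r\<in>W. p \<bullet> q = -1 \<and> p \<bullet> r = -1 \<and> q \<bullet> r = -1")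
  case False
  then show ?thesis using no_negative_triple_matching[OF W] by blast
next
  case True
  then obtain h1 h2 h3 where pd1: "pillar_decomposition W h1 h2 h3"
    using negative_triple_gives_pillars[OF W] by blast
  note pd2 = pillar_decomposition_rotate[OF pd1]
  note pd3 = pillar_decomposition_rotate[OF pd2]
  have o: "h1 \<bullet> h1 = 1" "h2 \<bullet> h2 = 1" "h3 \<bullet> h3 = 1" "h1 \<bullet> h2 = 0" "h1 \<bullet> h3 = 0" "h2 \<bullet> h3 = 0"
    "h2 \<bullet> h1 = 0" "h3 \<bullet> h1 = 0" "h3 \<bullet> h2 = 0"
    using pd1 by (auto simp: pillar_decomposition_def orthonormal3_def inner_commute)
  show ?thesis
  proof (cases "\<exists>h\<in>{h1, h2, h3}. \<forall>x\<in>W. \<bar>x \<bullet> h\<bar> = 1")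
    case True
    then obtain h where "h \<bullet> h = 1" "\<forall>x\<in>W. \<bar>x \<bullet> h\<bar> = 1" using o by auto
    then show ?thesis using one_pillar_matching[OF W] by blast
  next
    case False
    have tet: "\<bar>t \<bullet> h\<bar> = 1" if "t \<in> tetrahedron h1 h2 h3" "h \<in> {h1, h2, h3}" for t h
      using that o by (auto simp: tetrahedron_def inner_add inner_diff)
    have off: "\<exists>x\<in>W. \<bar>x \<bullet> h\<bar> \<noteq> 1 \<and> (on_axis h1 h2 h3 x \<or> on_axis h2 h3 h1 x \<or> on_axis h3 h1 h2 x)"
      if h: "h \<in> {h1, h2, h3}" for h
    proof -
      obtain x where x: "x \<in> W" "\<bar>x \<bullet> h\<bar> \<noteq> 1" using False h by blast
      then have "x \<notin> tetrahedron h1 h2 h3" "- x \<notin> tetrahedron h1 h2 h3"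
        using tet[of x h] tet[of "- x" h] h by auto
      then show ?thesis using x pd1 unfolding pillar_decomposition_def by blast
    qed
    obtain x where x: "x \<in> W" "on_axis h2 h3 h1 x \<or> on_axis h3 h1 h2 x"
      using off[of h1] by (auto simp: on_axis_def)
    obtain y where y: "y \<in> W" "on_axis h1 h2 h3 y \<or> on_axis h3 h1 h2 y"
      using off[of h2] by (auto simp: on_axis_def)
    obtain z where z: "z \<in> W" "on_axis h1 h2 h3 z \<or> on_axis h2 h3 h1 z"
      using off[of h3] by (auto simp: on_axis_def)
    have "small_system W"
      using x y z two_pillars_small[OF W pd1] two_pillars_small[OF W pd2]
        two_pillars_small[OF W pd3] by blast
    then show ?thesis by blast
  qed
qed

section \<open>Representing vectors and switching classes\<close>

definition representing :: "nat \<Rightarrow> (nat \<Rightarrow> 'a::real_inner) \<Rightarrow> 'a set set \<Rightarrow> bool"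
  where "representing n v U \<longleftrightarrow> U = (\<lambda>i. span {v i}) ` {..<n} \<and> (\<forall>i<n. v i \<bullet> v i = 3) \<and>
    (\<forall>i<n. \<forall>j<n. i \<noteq> j \<longrightarrow> \<bar>v i \<bullet> v j\<bar> = 1)"

lemma representing_inner:
  assumes "representing n v U" "i < n" "j < n"
  shows "i = j \<Longrightarrow> v i \<bullet> v j = 3" "i \<noteq> j \<Longrightarrow> \<bar>v i \<bullet> v j\<bar> = 1"
  using assms by (auto simp: representing_def)

lemma same_norm_on_line:
  fixes x y :: "'a::real_inner"
  assumes "x \<in> span {y}" "x \<bullet> x = c" "y \<bullet> y = c" "c \<noteq> 0"
  shows "x = y \<or> x = - y"
proof -
  obtain k where k: "x = k *\<^sub>R y" using assms(1) by (auto simp: span_singleton)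
  then have "k * k = 1" using assms by simp
  then have "k = 1 \<or> k = -1" by (simp add: square_eq_1_iff)
  then show ?thesis using k by auto
qed

lemma representing_inj:
  assumes r: "representing n v U" and ij: "i < n" "j < n" "span {v i} = span {v j}"
  shows "i = j"
proof (rule ccontr)
  assume ne: "i \<noteq> j"
  have "v i \<in> span {v j}" using ij(3) span_base[of "v i" "{v i}"] by auto
  then have "v i = v j \<or> v i = - v j"
    using same_norm_on_line[of "v i" "v j" 3] representing_inner(1)[OF r] ij by auto
  then show False
    using representing_inner(2)[OF r ij(1,2) ne] representing_inner(1)[OF r ij(2,2)] by auto
qed

lemma representing_card:
  assumes "representing n v U"
  shows "finite U" "card U = n"
proof -
  have "inj_on (\<lambda>i. span {v i}) {..<n}"
    using representing_inj[OF assms] by (auto intro: inj_onI)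
  moreover have "U = (\<lambda>i. span {v i}) ` {..<n}" using assms by (simp add: representing_def)
  ultimately show "finite U" "card U = n" by (auto simp: card_image)
qed

lemma representing_span:
  assumes "representing n v U"
  shows "span (\<Union>U) = span (v ` {..<n})"
proof -
  have U: "U = (\<lambda>i. span {v i}) ` {..<n}" using assms by (simp add: representing_def)
  have "span {v i} \<subseteq> span (v ` {..<n})" if "i < n" for i
    using that by (intro span_mono) auto
  then have "span (\<Union>U) \<subseteq> span (v ` {..<n})"
    unfolding U by (intro span_minimal) auto
  moreover have "v ` {..<n} \<subseteq> \<Union>U" unfolding U by (auto intro: span_base)
  ultimately show ?thesis by (meson span_mono subset_antisym)
qed

text \<open>
  Define \<open>f\<close> on a basis \<open>B\<close> chosen among the \<open>v i\<close>. It preserves inner products by bilinearity, and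
  for every \<open>i\<close> the vector \<open>f (v i) - w i\<close> has square length \<open>0\<close>, because
  \<open>f x \<bullet> w i = x \<bullet> v i\<close> on the span of \<open>B\<close>.
\<close>

lemma isometry_from_gram:
  fixes v :: "'i \<Rightarrow> 'a::real_inner" and w :: "'i \<Rightarrow> 'b::real_inner"
  assumes gram: "\<And>i j. i \<in> I \<Longrightarrow> j \<in> I \<Longrightarrow> v i \<bullet> v j = w i \<bullet> w j"
  shows "\<exists>f. linear f \<and> (\<forall>i\<in>I. f (v i) = w i) \<and>
    (\<forall>x\<in>span (v ` I). \<forall>y\<in>span (v ` I). f x \<bullet> f y = x \<bullet> y)"
proof -
  obtain B where B: "B \<subseteq> v ` I" "independent B" "v ` I \<subseteq> span B"
    using maximal_independent_subset[of "v ` I"] by blast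
  have "\<forall>b\<in>B. \<exists>i\<in>I. v i = b" using B(1) by blast
  then obtain k where k: "\<And>b. b \<in> B \<Longrightarrow> k b \<in> I \<and> v (k b) = b" by metis
  obtain f where f: "linear f" "\<And>b. b \<in> B \<Longrightarrow> f b = w (k b)"
    using linear_independent_extend[OF B(2), of "\<lambda>b. w (k b)"] by blast
  note lin = linear_add[OF f(1)] linear_scale[OF f(1)] linear_0[OF f(1)]
  have sp: "span (v ` I) = span B"
    using B by (meson span_mono span_minimal subspace_span subset_antisym)
  have fw: "f x \<bullet> w i = x \<bullet> v i" if "x \<in> span B" "i \<in> I" for x i
    using that(1)
  proof (rule span_induct)
    show "subspace {x. f x \<bullet> w i = x \<bullet> v i}"
      by (auto simp: subspace_def lin inner_add)
    show "f b \<bullet> w i = b \<bullet> v i" if "b \<in> B" for b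
      using f(2)[OF that] gram[of "k b" i] k[OF that] \<open>i \<in> I\<close> by simp
  qed
  have ff: "f x \<bullet> f y = x \<bullet> y" if "x \<in> span B" "y \<in> span B" for x y
    using that(2)
  proof (rule span_induct)
    show "subspace {y. f x \<bullet> f y = x \<bullet> y}"
      by (auto simp: subspace_def lin inner_add)
    show "f x \<bullet> f b = x \<bullet> b" if "b \<in> B" for b
      using fw[OF \<open>x \<in> span B\<close>, of "k b"] f(2)[OF that] k[OF that] by simp
  qed
  have "f (v i) = w i" if i: "i \<in> I" for i
  proof -
    have vi: "v i \<in> span B" using B(3) i by blast
    have "(f (v i) - w i) \<bullet> (f (v i) - w i) = 0"
      using ff[OF vi vi] fw[OF vi i] gram[OF i i] by (simp add: inner_diff inner_commute)
    then show ?thesis by simp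
  qed
  then show ?thesis using f(1) ff sp by auto
qed

lemma lines_equiv_if_same_gram:
  assumes v: "representing n v U" and w: "representing n w U'"
    and gram: "\<And>i j. i < n \<Longrightarrow> j < n \<Longrightarrow> v i \<bullet> v j = w i \<bullet> w j"
  shows "lines_equiv U U'"
proof -
  obtain f where f: "linear f" "\<And>i. i < n \<Longrightarrow> f (v i) = w i"
    "\<And>x y. x \<in> span (v ` {..<n}) \<Longrightarrow> y \<in> span (v ` {..<n}) \<Longrightarrow> f x \<bullet> f y = x \<bullet> y"
    using isometry_from_gram[of "{..<n}" v w] gram by auto
  have "f ` span (v ` {..<n}) = span (f ` v ` {..<n})"
    by (rule linear_span_image[OF f(1), symmetric])
  also have "f ` v ` {..<n} = w ` {..<n}"
    using f(2) by force
  finally have 1: "f ` span (\<Union>U) = span (\<Union>U')"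
    using representing_span[OF v] representing_span[OF w] by simp
  have "f ` span {v i} = span {w i}" if "i < n" for i
    using linear_span_image[OF f(1), of "{v i}"] f(2)[OF that] by simp
  then have 2: "(\<lambda>l. f ` l) ` U = U'"
    using v w by (simp add: representing_def image_image)
  show ?thesis
    unfolding lines_equiv_def
    using 1 2 f(3) representing_span[OF v]
    by (intro exI[of _ f]) (simp add: linear_add[OF f(1)] linear_scale[OF f(1)])
qed

text \<open>
  The isometry of an equivalence maps spanning vectors to spanning vectors.
\<close>

lemma lines_equiv_transfer:
  assumes "lines_equiv U U'" and v: "representing n v U"
  shows "\<exists>w. representing n w U' \<and> (\<forall>i<n. \<forall>j<n. w i \<bullet> w j = v i \<bullet> v j)"
proof -
  obtain f where f: "\<forall>c. \<forall>x\<in>span (\<Union>U). f (c *\<^sub>R x) = c *\<^sub>R f x"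
    "\<forall>x\<in>span (\<Union>U). \<forall>y\<in>span (\<Union>U). f x \<bullet> f y = x \<bullet> y" "(\<lambda>l. f ` l) ` U = U'"
    using assms(1) unfolding lines_equiv_def by blast
  have vi: "v i \<in> span (\<Union>U)" if "i < n" for i
    using representing_span[OF v] that by (auto intro: span_base)
  then have gram: "f (v i) \<bullet> f (v j) = v i \<bullet> v j" if "i < n" "j < n" for i j
    using f(2) that by blast
  have "f ` span {v i} = span {f (v i)}" if "i < n" for i
    using f(1) vi[OF that] by (simp add: span_singleton image_image)
  then have "(\<lambda>l. f ` l) ` (\<lambda>i. span {v i}) ` {..<n} = (\<lambda>i. span {f (v i)}) ` {..<n}"
    unfolding image_image by (intro image_cong) auto
  then have "U' = (\<lambda>i. span {f (v i)}) ` {..<n}"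
    using v f(3) by (simp add: representing_def)
  then have "representing n (\<lambda>i. f (v i)) U'"
    using v gram by (simp add: representing_def)
  then show ?thesis using gram by blast
qed

definition sign_pattern :: "nat \<Rightarrow> (nat \<Rightarrow> 'a::real_inner) \<Rightarrow> (nat \<times> nat) set"
  where "sign_pattern n v = {(i, j). i < n \<and> j < n \<and> v i \<bullet> v j > 0}"

text \<open>
  For a representing family the Gram matrix and the sign pattern determine each other. Reordering the
  lines permutes the indices and replacing \<open>v i\<close> by \<open>- v i\<close> switches the pattern, so this set is
  a full switching class of Seidel matrices, in all orderings.
\<close>

definition switching_class :: "nat \<Rightarrow> 'a::real_inner set set \<Rightarrow> (nat \<times> nat) set set"
  where "switching_class n U = {sign_pattern n v | v. representing n v U}"

lemma gram_eq_if_sign_pattern_eq: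
  assumes "representing n v U" "representing n w U'" "sign_pattern n v = sign_pattern n w"
    and ij: "i < n" "j < n"
  shows "v i \<bullet> v j = w i \<bullet> w j"
proof -
  have "(i, j) \<in> sign_pattern n v \<longleftrightarrow> (i, j) \<in> sign_pattern n w" using assms by simp
  then have "v i \<bullet> v j > 0 \<longleftrightarrow> w i \<bullet> w j > 0" using ij by (simp add: sign_pattern_def)
  then show ?thesis
    using representing_inner[OF assms(1) ij] representing_inner[OF assms(2) ij]
    by (cases "i = j") auto
qed

lemma switching_class_overlap:
  assumes "switching_class n U \<inter> switching_class n U' \<noteq> {}"
  shows "lines_equiv U U'"
proof -
  obtain v w where "representing n v U" "representing n w U'" "sign_pattern n v = sign_pattern n w"
    using assms by (auto simp: switching_class_def)
  then show ?thesis
    by (intro lines_equiv_if_same_gram[of n v U w U'] gram_eq_if_sign_pattern_eq[of n v U w U'])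
qed

lemma switching_class_mono:
  assumes "lines_equiv U U'"
  shows "switching_class n U \<subseteq> switching_class n U'"
proof
  fix P assume "P \<in> switching_class n U"
  then obtain v where v: "representing n v U" "P = sign_pattern n v"
    by (auto simp: switching_class_def)
  then obtain w where "representing n w U'" "\<forall>i<n. \<forall>j<n. w i \<bullet> w j = v i \<bullet> v j"
    using lines_equiv_transfer[OF assms] by blast
  moreover from this have "P = sign_pattern n w"
    unfolding v(2) sign_pattern_def by auto
  ultimately show "P \<in> switching_class n U'"
    unfolding switching_class_def by blast
qed

text \<open>
  An equivalence gives an inclusion of switching classes. A common pattern gives
  an equivalence in both directions, which turns the inclusion into an equality.
\<close>

lemma lines_equiv_iff_switching_class:
  assumes "representing n v U" "representing n v' U'"
  shows "lines_equiv U U' \<longleftrightarrow> switching_class n U = switching_class n U'"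
proof
  have ne: "switching_class n U \<noteq> {}" "switching_class n U' \<noteq> {}"
    using assms by (auto simp: switching_class_def)
  assume "lines_equiv U U'"
  then have sub: "switching_class n U \<subseteq> switching_class n U'" by (rule switching_class_mono)
  then have "lines_equiv U' U" using ne by (intro switching_class_overlap[of n]) auto
  then show "switching_class n U = switching_class n U'"
    using sub switching_class_mono by blast
next
  assume "switching_class n U = switching_class n U'"
  moreover have "switching_class n U \<noteq> {}" using assms by (auto simp: switching_class_def)
  ultimately show "lines_equiv U U'" by (intro switching_class_overlap[of n]) auto
qed

lemma finite_switching_classes: "finite (switching_class n ` X)"
proof (rule finite_subset)
  show "switching_class n ` X \<subseteq> Pow (Pow ({..<n} \<times> {..<n}))"
    by (auto simp: switching_class_def sign_pattern_def)
qed simp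

text \<open>
  Equivalence is the kernel of the map \<open>switching_class n\<close>, so its classes are the nonempty
  fibres of this map.
\<close>

lemma num_classes_eq_card_switching_classes:
  assumes "\<And>U. U \<in> X \<Longrightarrow> \<exists>v. representing n v U"
  shows "num_classes X = card (switching_class n ` X)"
proof -
  let ?h = "switching_class n"
  have rel: "{(U, U'). U \<in> X \<and> U' \<in> X \<and> lines_equiv U U'} = {(U, U'). U \<in> X \<and> U' \<in> X \<and> ?h U = ?h U'}"
    using assms lines_equiv_iff_switching_class by blast
  have "X // {(U, U'). U \<in> X \<and> U' \<in> X \<and> ?h U = ?h U'} = (\<lambda>c. {U \<in> X. ?h U = c}) ` ?h ` X"
    by (auto simp: quotient_def Image_def image_iff)
  moreover have "inj_on (\<lambda>c. {U \<in> X. ?h U = c}) (?h ` X)"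
    by (auto simp: inj_on_def)
  ultimately show ?thesis
    unfolding num_classes_def rel by (simp add: card_image)
qed

lemma dim_le_if_same_gram:
  assumes v: "representing n v U" and w: "representing n w U'"
    and gram: "\<And>i j. i < n \<Longrightarrow> j < n \<Longrightarrow> v i \<bullet> v j = w i \<bullet> w j"
  shows "dim (span (\<Union>U')) \<le> dim (span (\<Union>U))"
proof -
  obtain f where f: "linear f" "\<And>i. i < n \<Longrightarrow> f (v i) = w i"
    using isometry_from_gram[of "{..<n}" v w] gram by auto
  obtain B where B: "B \<subseteq> v ` {..<n}" "independent B" "v ` {..<n} \<subseteq> span B" "card B = dim (v ` {..<n})"
    using basis_exists by blast
  have fin: "finite B" using B(1) finite_subset by blast
  have "w ` {..<n} = f ` v ` {..<n}" using f(2) by force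
  also have "\<dots> \<subseteq> span (f ` B)"
    using B(3) linear_span_image[OF f(1), of B] by blast
  finally have "dim (w ` {..<n}) \<le> card (f ` B)" by (rule dim_le_card) (simp add: fin)
  also have "\<dots> \<le> dim (v ` {..<n})" using card_image_le[OF fin, of f] B(4) by simp
  finally show ?thesis using representing_span[OF v] representing_span[OF w] by simp
qed

lemma dim_eq_if_switching_class_eq:
  assumes "representing n v U" "representing n v' U'" "switching_class n U = switching_class n U'"
  shows "dim (span (\<Union>U)) = dim (span (\<Union>U'))"
proof -
  have "sign_pattern n v \<in> switching_class n U'"
    using assms(1,3) unfolding switching_class_def by blast
  then obtain w where "representing n w U'" "sign_pattern n v = sign_pattern n w"
    by (auto simp: switching_class_def)
  then show ?thesis
    using assms(1)
    by (intro order_antisym dim_le_if_same_gram[of n v U w U'] dim_le_if_same_gram[of n w U' v U]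
      gram_eq_if_sign_pattern_eq[of n v U w U'] gram_eq_if_sign_pattern_eq[of n w U' v U]) auto
qed


section \<open>Line sets in the sequence space\<close>

lift_definition unit_vec :: "nat \<Rightarrow> fseq" is "\<lambda>k i. if i = k then 1 else 0"
  by simp

lemma inner_unit_vec: "unit_vec k \<bullet> unit_vec l = (if k = l then 1 else 0)"
  by (subst inner_fseq_superset[of "{k}"]) (auto simp: unit_vec.rep_eq)

lemma unit_vec_in_euclidean: "k < d \<Longrightarrow> unit_vec k \<in> euclidean d"
  by (auto simp: euclidean_def unit_vec.rep_eq)

lemma subspace_euclidean: "subspace (euclidean d)"
  by (auto simp: subspace_def euclidean_def zero_fseq.rep_eq plus_fseq.rep_eq scaleR_fseq.rep_eq)

lemma coord_sum: "coord (\<Sum>i\<in>A. g i) k = (\<Sum>i\<in>A. coord (g i) k)"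
  by (induction A rule: infinite_finite_induct) (auto simp: zero_fseq.rep_eq plus_fseq.rep_eq)

lemma euclidean_subset_span: "euclidean d \<subseteq> span (unit_vec ` {..<d})"
proof
  fix x assume x: "x \<in> euclidean d"
  have "x = (\<Sum>k<d. coord x k *\<^sub>R unit_vec k)"
  proof (rule coord_inject[THEN iffD1], rule ext)
    fix i
    show "coord x i = coord (\<Sum>k<d. coord x k *\<^sub>R unit_vec k) i"
      using x by (cases "i < d")
        (auto simp: coord_sum scaleR_fseq.rep_eq unit_vec.rep_eq euclidean_def if_distrib[of "(*) _"] cong: if_cong)
  qed
  also have "\<dots> \<in> span (unit_vec ` {..<d})"
    by (intro span_sum span_scale span_base) auto
  finally show "x \<in> span (unit_vec ` {..<d})" .
qed

lemma arccos_third_iff: "\<bar>x\<bar> \<le> 1 \<Longrightarrow> arccos x = arccos (1/3) \<longleftrightarrow> x = 1/3"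
  by (rule arccos_eq_iff) auto

lemma line_sets_representing:
  assumes "U \<in> line_sets d n"
  shows "\<exists>v. representing n v U \<and> (\<forall>i<n. v i \<in> euclidean d)"
proof -
  have U: "finite U" "card U = n" "\<And>l. l \<in> U \<Longrightarrow> l \<subseteq> euclidean d" "\<And>l. l \<in> U \<Longrightarrow> is_line l"
    and ang: "\<And>l m. l \<in> U \<Longrightarrow> m \<in> U \<Longrightarrow> l \<noteq> m \<Longrightarrow> lines_at_angle (arccos (1/3)) l m"
    using assms by (auto simp: line_sets_def equiangular_def)
  have "\<exists>x. x \<bullet> x = 3 \<and> l = span {x}" if l: "l \<in> U" for l
  proof -
    obtain y where y: "y \<noteq> 0" "l = span {y}" using U(4)[OF l] by (auto simp: is_line_def)
    define c where "c = sqrt 3 / norm y"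
    have "c \<noteq> 0" using y by (simp add: c_def)
    have "(c *\<^sub>R y) \<bullet> (c *\<^sub>R y) = 3"
      using y(1) by (simp add: c_def power2_norm_eq_inner[symmetric] power2_eq_square field_simps)
    moreover have "span {c *\<^sub>R y} = l"
    proof -
      have "y = (1 / c) *\<^sub>R c *\<^sub>R y" using \<open>c \<noteq> 0\<close> by simp
      then have "y \<in> span {c *\<^sub>R y}" by (metis span_base span_scale singletonI)
      then show ?thesis unfolding y(2) by (simp add: span_eq span_base span_scale)
    qed
    ultimately show ?thesis by blast
  qed
  then have "\<forall>l\<in>U. \<exists>x. x \<bullet> x = 3 \<and> l = span {x}" by blast
  from bchoice[OF this] obtain x
    where x: "\<And>l. l \<in> U \<Longrightarrow> x l \<bullet> x l = 3" and lx: "\<And>l. l \<in> U \<Longrightarrow> l = span {x l}"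
    by blast
  obtain g where g: "bij_betw g {..<n} U"
    using ex_bij_betw_nat_finite[OF U(1)] U(2) by (auto simp: atLeast0LessThan)
  then have gU: "g i \<in> U" if "i < n" for i using that by (auto simp: bij_betw_def)
  have xl: "x l \<in> l" if "l \<in> U" for l
    by (rule lx[OF that, THEN equalityD2, THEN subsetD]) (simp add: span_base)
  have ip: "\<bar>x l \<bullet> x m\<bar> = 1" if lm: "l \<in> U" "m \<in> U" "l \<noteq> m" for l m
  proof -
    have ne: "x l \<noteq> 0" "x m \<noteq> 0" using x[of l] x[of m] lm by auto
    have nn: "norm (x l) * norm (x m) = 3"
      using x[of l] x[of m] lm by (simp add: norm_eq_sqrt_inner)
    have "arccos (\<bar>x l \<bullet> x m\<bar> / (norm (x l) * norm (x m))) = arccos (1/3)"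
      using ang[OF lm] xl[OF lm(1)] xl[OF lm(2)] ne unfolding lines_at_angle_def by blast
    then have "arccos (\<bar>x l \<bullet> x m\<bar> / 3) = arccos (1/3)" unfolding nn .
    moreover have "\<bar>x l \<bullet> x m\<bar> \<le> 3"
      using Cauchy_Schwarz_ineq2[of "x l" "x m"] nn by simp
    ultimately show ?thesis using arccos_third_iff[of "\<bar>x l \<bullet> x m\<bar> / 3"] by simp
  qed
  have "representing n (\<lambda>i. x (g i)) U"
    unfolding representing_def
  proof (intro conjI allI impI)
    have "(\<lambda>i. span {x (g i)}) ` {..<n} = (\<lambda>l. span {x l}) ` U"
      using g by (auto simp: bij_betw_def)
    also have "\<dots> = (\<lambda>l. l) ` U"
      by (rule image_cong[OF refl]) (rule lx[symmetric])
    finally show "U = (\<lambda>i. span {x (g i)}) ` {..<n}" by simp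
    show "x (g i) \<bullet> x (g i) = 3" if "i < n" for i using x gU[OF that] by blast
    show "\<bar>x (g i) \<bullet> x (g j)\<bar> = 1" if "i < n" "j < n" "i \<noteq> j" for i j
    proof (rule ip)
      show "g i \<noteq> g j" using that g by (auto simp: bij_betw_def inj_on_def)
    qed (use gU that in auto)
  qed
  then show ?thesis using U(3) xl gU by blast
qed

lemma representing_in_line_sets:
  assumes v: "representing n v U" and d: "\<And>i. i < n \<Longrightarrow> v i \<in> euclidean d"
  shows "U \<in> line_sets d n"
proof -
  have U: "U = (\<lambda>i. span {v i}) ` {..<n}" using v by (simp add: representing_def)
  have "span {v i} \<subseteq> euclidean d" if "i < n" for i
    using d[OF that] subspace_euclidean by (intro span_minimal) auto
  moreover have "is_line (span {v i})" if "i < n" for i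
    unfolding is_line_def using representing_inner(1)[OF v that that] by (intro exI[of _ "v i"]) auto
  moreover have "lines_at_angle (arccos (1/3)) (span {v i}) (span {v j})"
    if ij: "i < n" "j < n" "span {v i} \<noteq> span {v j}" for i j
    unfolding lines_at_angle_def
  proof (intro ballI impI)
    fix x y assume xy: "x \<in> span {v i}" "y \<in> span {v j}" "x \<noteq> 0" "y \<noteq> 0"
    then obtain a b where ab: "x = a *\<^sub>R v i" "y = b *\<^sub>R v j" by (auto simp: span_singleton)
    then have ne: "a \<noteq> 0" "b \<noteq> 0" using xy by auto
    have "\<bar>v i \<bullet> v j\<bar> = 1" using representing_inner(2)[OF v] ij by auto
    moreover have "norm (v i) * norm (v j) = 3"
      using representing_inner(1)[OF v] ij by (simp add: norm_eq_sqrt_inner)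
    ultimately have "\<bar>x \<bullet> y\<bar> = \<bar>a\<bar> * \<bar>b\<bar>" "norm x * norm y = 3 * (\<bar>a\<bar> * \<bar>b\<bar>)"
      by (simp_all add: ab abs_mult)
    then show "arccos (\<bar>x \<bullet> y\<bar> / (norm x * norm y)) = arccos (1/3)" using ne by simp
  qed
  ultimately show ?thesis
    using representing_card[OF v] unfolding line_sets_def equiangular_def U by auto
qed

lemma Union_line_sets: "(\<Union>d. line_sets d n) = {U. \<exists>v. representing n v U}"
proof (intro equalityI subsetI CollectI)
  fix U assume "U \<in> (\<Union>d. line_sets d n)"
  then show "\<exists>v. representing n v U" using line_sets_representing by blast
next
  fix U :: "fseq set set" assume "U \<in> {U. \<exists>v. representing n v U}"
  then obtain v where v: "representing n v U" by blast
  have "finite (\<Union>i<n. {k. coord (v i) k \<noteq> 0})" using finite_coord by blast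
  then obtain d where d: "\<forall>k\<in>(\<Union>i<n. {k. coord (v i) k \<noteq> 0}). k < d"
    unfolding finite_nat_set_iff_bounded ..
  have "v i \<in> euclidean d" if "i < n" for i
    unfolding euclidean_def
  proof (intro CollectI allI impI)
    fix k assume "d \<le> k"
    then have "k \<notin> (\<Union>i<n. {k. coord (v i) k \<noteq> 0})" using d by (meson not_less)
    then show "coord (v i) k = 0" using that by blast
  qed
  then show "U \<in> (\<Union>d. line_sets d n)" using representing_in_line_sets[OF v] by blast
qed

text \<open>
  The zero vector may belong to \<open>C\<close>: its summand is \<open>0 / 0 = 0\<close>.
\<close>

lemma orthogonal_parseval:
  fixes x y :: "'a::real_inner"
  assumes fin: "finite C" and orth: "pairwise orthogonal C" and y: "y \<in> span C"
  shows "x \<bullet> y = (\<Sum>c\<in>C. (x \<bullet> c) * (y \<bullet> c) / (c \<bullet> c))"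
  using y
proof (rule span_induct)
  show "subspace {y. x \<bullet> y = (\<Sum>c\<in>C. (x \<bullet> c) * (y \<bullet> c) / (c \<bullet> c))}"
    by (auto simp: subspace_def inner_add algebra_simps add_divide_distrib sum.distrib sum_distrib_left)
  show "x \<bullet> y = (\<Sum>c\<in>C. (x \<bullet> c) * (y \<bullet> c) / (c \<bullet> c))" if yC: "y \<in> C" for y
  proof -
    have "(\<Sum>c\<in>C. (x \<bullet> c) * (y \<bullet> c) / (c \<bullet> c)) = (\<Sum>c\<in>C. if c = y then x \<bullet> y else 0)"
      using orth yC by (intro sum.cong) (auto simp: pairwise_def orthogonal_def)
    then show ?thesis using fin yC by simp
  qed
qed

text \<open>
  An orthogonal set \<open>C\<close> spanning the \<open>v i\<close> is sent to distinct unit vectors, after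
  normalisation. A zero vector in \<open>C\<close> gets coefficient \<open>0\<close> by the convention \<open>x / 0 = 0\<close>.
\<close>

lemma embed_in_euclidean:
  fixes v :: "nat \<Rightarrow> 'a::real_inner"
  assumes d: "dim (v ` {..<n}) \<le> d"
  shows "\<exists>w. (\<forall>i<n. w i \<in> euclidean d) \<and> (\<forall>i<n. \<forall>j<n. w i \<bullet> w j = v i \<bullet> v j)"
proof -
  obtain B where B: "B \<subseteq> v ` {..<n}" "v ` {..<n} \<subseteq> span B" "card B = dim (v ` {..<n})"
    using basis_exists[of "v ` {..<n}"] by metis
  then have "finite B" using finite_subset by blast
  then obtain C where C: "finite C" "card C \<le> card B" "span C = span B" "pairwise orthogonal C"
    using basis_orthogonal by blast
  obtain g where g: "bij_betw g C {..<card C}"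
    using ex_bij_betw_finite_nat[OF C(1)] by (auto simp: atLeast0LessThan)
  have gi: "g c = g c' \<longleftrightarrow> c = c'" if "c \<in> C" "c' \<in> C" for c c'
    using g that by (auto simp: bij_betw_def inj_on_def)
  have gd: "g c < d" if "c \<in> C" for c
  proof -
    have "g c \<in> {..<card C}" using g that by (auto simp: bij_betw_def)
    then show ?thesis using C(2) B(3) d by simp
  qed
  define w where "w i = (\<Sum>c\<in>C. (v i \<bullet> c / norm c) *\<^sub>R unit_vec (g c))" for i
  have "w i \<in> euclidean d" for i
    unfolding w_def using gd unit_vec_in_euclidean subspace_euclidean
    by (intro subspace_sum subspace_scale) auto
  moreover have "w i \<bullet> w j = v i \<bullet> v j" if "i < n" "j < n" for i j
  proof -
    have "w i \<bullet> w j = (\<Sum>c\<in>C. \<Sum>c'\<in>C. (v i \<bullet> c / norm c) * ((v j \<bullet> c' / norm c') * (if c = c' then 1 else 0)))"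
      unfolding w_def inner_sum_left inner_sum_right
      by (intro sum.cong) (simp_all add: inner_unit_vec gi)
    also have "\<dots> = (\<Sum>c\<in>C. (v i \<bullet> c) * (v j \<bullet> c) / (c \<bullet> c))"
      using C(1) by (intro sum.cong) (simp_all add: if_distrib[of "(*) _"] power2_norm_eq_inner[symmetric] power2_eq_square cong: if_cong)
    also have "\<dots> = v i \<bullet> v j"
      using orthogonal_parseval[OF C(1,4), of "v j" "v i"] B(2) C(3) that by auto
    finally show ?thesis .
  qed
  ultimately show ?thesis by blast
qed

text \<open>
  Up to equivalence, lying in a fixed \<open>d\<close>-dimensional space means having a span of dimension at
  most \<open>d\<close>. This makes the count in dimension \<open>7\<close> a part of the count in arbitrary dimension.
\<close>

lemma switching_classes_line_sets:
  "switching_class n ` line_sets d n =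
    switching_class n ` {U \<in> (\<Union>d. line_sets d n). dim (span (\<Union>U)) \<le> d}"
proof (intro equalityI subsetI)
  fix P assume "P \<in> switching_class n ` line_sets d n"
  then obtain U where U: "U \<in> line_sets d n" "P = switching_class n U" by blast
  obtain v where v: "representing n v U" "\<forall>i<n. v i \<in> euclidean d"
    using line_sets_representing[OF U(1)] by blast
  have "v ` {..<n} \<subseteq> span (unit_vec ` {..<d})" using v(2) euclidean_subset_span by blast
  then have "dim (v ` {..<n}) \<le> card (unit_vec ` {..<d})" by (rule dim_le_card) simp
  also have "\<dots> \<le> d" using card_image_le[of "{..<d}" unit_vec] by simp
  finally have "dim (span (\<Union>U)) \<le> d" using representing_span[OF v(1)] by simp
  then show "P \<in> switching_class n ` {U \<in> (\<Union>d. line_sets d n). dim (span (\<Union>U)) \<le> d}"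
    using U by blast
next
  fix P assume "P \<in> switching_class n ` {U \<in> (\<Union>d. line_sets d n). dim (span (\<Union>U)) \<le> d}"
  then obtain U where "U \<in> (\<Union>d. line_sets d n)" and U1: "dim (span (\<Union>U)) \<le> d" "P = switching_class n U"
    by blast
  then obtain v where "representing n v U"
    unfolding Union_line_sets by blast
  note U = U1 this
  obtain w where w: "\<forall>i<n. w i \<in> euclidean d" "\<forall>i<n. \<forall>j<n. w i \<bullet> w j = v i \<bullet> v j"
    using embed_in_euclidean[of v n d] U(1) representing_span[OF U(3)] by auto
  let ?U = "(\<lambda>i. span {w i}) ` {..<n}"
  have r: "representing n w ?U" using w(2) U(3) by (simp add: representing_def)
  have "lines_equiv U ?U" using lines_equiv_if_same_gram[OF U(3) r] w(2) by simp
  then have "P = switching_class n ?U"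
    using lines_equiv_iff_switching_class[OF U(3) r] U(2) by blast
  then show "P \<in> switching_class n ` line_sets d n"
    using representing_in_line_sets[OF r] w(1) by blast
qed

section \<open>Standard matching configurations\<close>

text \<open>
  The standard matching with \<open>a\<close> edges on the natural numbers: it joins \<open>0\<close> to \<open>1\<close>, \<open>2\<close> to \<open>3\<close>, up
  to \<open>2 a - 2\<close> to \<open>2 a - 1\<close>.
\<close>

definition std_edge :: "nat \<Rightarrow> nat \<Rightarrow> nat \<Rightarrow> bool"
  where "std_edge a i j \<longleftrightarrow> i \<noteq> j \<and> i div 2 = j div 2 \<and> i < 2 * a \<and> j < 2 * a"

definition matching_pattern :: "nat \<Rightarrow> nat \<Rightarrow> (nat \<times> nat) set"
  where "matching_pattern n a = {(i, j). i < n \<and> j < n \<and> \<not> std_edge a i j}"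

definition matching_axis :: "nat \<Rightarrow> nat \<Rightarrow> nat"
  where "matching_axis a i = (if i < 2 * a then Suc (i div 2) else Suc i)"

text \<open>
  The configuration of a single pillar with axis \<open>unit_vec 0\<close>: partners in the matching are
  the axis plus opposite roots \<open>\<plusminus> sqrt 2 e\<^sub>k\<close>, and the roots of different pairs are orthogonal.
\<close>

definition matching_vec :: "nat \<Rightarrow> nat \<Rightarrow> fseq"
  where "matching_vec a i =
    unit_vec 0 + (if i < 2 * a \<and> odd i then - sqrt 2 else sqrt 2) *\<^sub>R unit_vec (matching_axis a i)"

definition matching_lines :: "nat \<Rightarrow> nat \<Rightarrow> fseq set set"
  where "matching_lines n a = (\<lambda>i. span {matching_vec a i}) ` {..<n}"

lemma eq_if_same_half_parity: "i div 2 = j div 2 \<Longrightarrow> odd i = odd j \<Longrightarrow> i = (j::nat)"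
  by (metis dvd_mult_div_cancel even_Suc odd_Suc_div_two odd_two_times_div_two_succ)

lemma matching_vec_inner:
  "matching_vec a i \<bullet> matching_vec a j = (if i = j then 3 else if std_edge a i j then - 1 else 1)"
proof -
  have ax: "matching_axis a i = matching_axis a j \<longleftrightarrow> i = j \<or> std_edge a i j"
    by (auto simp: matching_axis_def std_edge_def)
  have ax0: "matching_axis a i \<noteq> 0" "matching_axis a j \<noteq> 0"
    by (auto simp: matching_axis_def)
  have par: "odd i \<noteq> odd j" if "std_edge a i j"
    using that eq_if_same_half_parity[of i j] by (auto simp: std_edge_def)
  show ?thesis
    using ax ax0 par
    by (auto simp: matching_vec_def inner_add inner_unit_vec std_edge_def)
qed

lemma matching_lines_representing: "representing n (matching_vec a) (matching_lines n a)"
  by (auto simp: representing_def matching_lines_def matching_vec_inner)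

lemma matching_pattern_in_switching_class:
  "matching_pattern n a \<in> switching_class n (matching_lines n a)"
proof -
  have "sign_pattern n (matching_vec a) = matching_pattern n a"
    by (auto simp: sign_pattern_def matching_pattern_def matching_vec_inner std_edge_def split: if_splits)
  then show ?thesis
    using matching_lines_representing unfolding switching_class_def by blast
qed

text \<open>
  Adding the axis \<open>unit_vec 0\<close> to the vectors gives the span of \<open>n + 1 - a\<close> unit vectors. If there is an edge,
  the axis is half the sum of its two ends and already lies in the span. Without edges
  adding it raises the dimension by at most one.
\<close>

lemma dim_matching_lines:
  assumes a: "2 * a \<le> n"
  shows "dim (span (\<Union>(matching_lines n a))) = (if a = 0 then n else n + 1 - a)"
proof -
  let ?M = "matching_vec a ` {..<n}"
  define K where "K = insert 0 (matching_axis a ` {..<n})"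
  have "matching_axis a ` {..<n} = Suc ` ({..<a} \<union> {2 * a..<n})"
  proof (intro equalityI subsetI)
    fix k assume "k \<in> Suc ` ({..<a} \<union> {2 * a..<n})"
    then consider i where "i < a" "k = Suc i" | i where "2 * a \<le> i" "i < n" "k = Suc i" by auto
    then show "k \<in> matching_axis a ` {..<n}"
    proof cases
      case 1
      then have "k = matching_axis a (2 * i)" "2 * i < n" using a by (auto simp: matching_axis_def)
      then show ?thesis by blast
    next
      case 2
      then have "k = matching_axis a i" by (auto simp: matching_axis_def)
      then show ?thesis using 2 by blast
    qed
  qed (auto simp: matching_axis_def)
  moreover have "card ({..<a} \<union> {2 * a..<n}) = n - a"
    using a by (subst card_Un_disjoint) auto
  ultimately have cK: "finite K" "card K = n + 1 - a"
    using a by (auto simp: K_def card_image)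
  have inj: "inj_on unit_vec K"
  proof (rule inj_onI)
    fix k l assume "unit_vec k = unit_vec l"
    then show "k = l" using inner_unit_vec[of k k] inner_unit_vec[of k l] by (auto split: if_splits)
  qed
  have "pairwise orthogonal (unit_vec ` K)"
    by (auto simp: pairwise_def orthogonal_def inner_unit_vec)
  moreover have "0 \<notin> unit_vec ` K"
  proof
    assume "0 \<in> unit_vec ` K"
    then obtain k where "unit_vec k = 0" by force
    then show False using inner_unit_vec[of k k] by simp
  qed
  ultimately have ind: "independent (unit_vec ` K)" by (rule pairwise_orthogonal_independent)
  have cE: "finite (unit_vec ` K)" "card (unit_vec ` K) = n + 1 - a"
    using cK inj by (auto simp: card_image)
  have E_sub: "unit_vec ` K \<subseteq> span (insert (unit_vec 0) ?M)"
  proof -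
    have "unit_vec (matching_axis a i) \<in> span (insert (unit_vec 0) ?M)" if "i < n" for i
    proof -
      define c where "c = (if i < 2 * a \<and> odd i then - sqrt 2 else sqrt 2)"
      have "c \<noteq> 0" by (simp add: c_def)
      then have "unit_vec (matching_axis a i) = (1 / c) *\<^sub>R (matching_vec a i - unit_vec 0)"
        by (simp add: matching_vec_def c_def)
      then show ?thesis using that by (simp add: span_base span_diff span_scale)
    qed
    then show ?thesis by (auto simp: K_def intro: span_base)
  qed
  have M_sub: "?M \<subseteq> span (unit_vec ` K)"
    unfolding matching_vec_def
    by (intro image_subsetI span_add span_scale span_base) (auto simp: K_def)
  have sp: "span (\<Union>(matching_lines n a)) = span ?M"
    by (rule representing_span[OF matching_lines_representing])
  show ?thesis
  proof (cases "a = 0")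
    case True
    obtain B where B: "B \<subseteq> ?M" "independent B" "?M \<subseteq> span B" "card B = dim ?M"
      using basis_exists by blast
    have fB: "finite B" using B(1) finite_subset by blast
    have "insert (unit_vec 0) ?M \<subseteq> span (insert (unit_vec 0) B)"
      using B(3) span_mono[of B "insert (unit_vec 0) B"] by (auto intro: span_base)
    then have "unit_vec ` K \<subseteq> span (insert (unit_vec 0) B)"
      using E_sub span_minimal[OF _ subspace_span] by blast
    then have "card (unit_vec ` K) \<le> card (insert (unit_vec 0) B)"
      using independent_span_bound[OF _ ind] fB by blast
    also have "\<dots> \<le> Suc (dim ?M)"
      using B(4) fB by (metis card_insert_le_m1 card_insert_if le_SucI order_refl)
    finally have "n \<le> dim ?M" using True cE by simp
    moreover have "dim ?M \<le> n"
      using dim_le_card'[of ?M] card_image_le[of "{..<n}" "matching_vec a"] by simp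
    ultimately show ?thesis using True sp by simp
  next
    case False
    have "unit_vec 0 = (1/2) *\<^sub>R (matching_vec a 0 + matching_vec a 1)"
      using False by (simp add: matching_vec_def matching_axis_def flip: scaleR_2)
    moreover have "matching_vec a 0 \<in> ?M" "matching_vec a 1 \<in> ?M" using False a by auto
    ultimately have "unit_vec 0 \<in> span ?M" by (metis span_add span_base span_scale)
    then have "span (insert (unit_vec 0) ?M) = span ?M" by (rule span_redundant)
    then have "span ?M = span (unit_vec ` K)"
      using E_sub M_sub by (metis span_eq)
    then have "dim (span ?M) = n + 1 - a"
      using dim_span_eq_card_independent[OF ind] cE by simp
    then show ?thesis using False sp by simp
  qed
qed

text \<open>
  The sign of \<open>(x \<bullet> y) (x \<bullet> z) (y \<bullet> z)\<close> does not depend on the signs of the three vectors, so it is an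
  invariant of three lines. Without edges it is always positive; with one edge it is negative for the two
  ends of the edge and a third line.
\<close>

lemma matching_lines_zero_one_inequivalent:
  assumes n: "3 \<le> n"
  shows "switching_class n (matching_lines n 0) \<noteq> switching_class n (matching_lines n 1)"
proof
  assume "switching_class n (matching_lines n 0) = switching_class n (matching_lines n 1)"
  then have "matching_pattern n 0 \<in> switching_class n (matching_lines n 1)"
    using matching_pattern_in_switching_class by blast
  then obtain v where v: "representing n v (matching_lines n 1)" "sign_pattern n v = matching_pattern n 0"
    by (auto simp: switching_class_def)
  have pos: "v i \<bullet> v j > 0" if "i < n" "j < n" for i j
  proof -
    have "(i, j) \<in> sign_pattern n v" using that v(2) by (simp add: matching_pattern_def std_edge_def)
    then show ?thesis by (simp add: sign_pattern_def)
  qed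
  have "\<exists>k c. k < n \<and> \<bar>c\<bar> = 1 \<and> matching_vec 1 i = c *\<^sub>R v k" if i: "i < n" for i
  proof -
    have "span {matching_vec 1 i} \<in> matching_lines n 1" using i by (simp add: matching_lines_def)
    then obtain k where k: "k < n" "span {matching_vec 1 i} = span {v k}"
      using v(1) by (auto simp: representing_def)
    have "matching_vec 1 i \<in> span {v k}" using k(2) span_base[of "matching_vec 1 i" "{matching_vec 1 i}"] by auto
    then have "matching_vec 1 i = v k \<or> matching_vec 1 i = - v k"
      using same_norm_on_line[of "matching_vec 1 i" "v k" 3] representing_inner(1)[OF v(1) k(1) k(1)]
      by (simp add: matching_vec_inner)
    then have "matching_vec 1 i = 1 *\<^sub>R v k \<or> matching_vec 1 i = (- 1) *\<^sub>R v k" by simp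
    then show ?thesis using k(1) by (metis abs_1 abs_minus_cancel)
  qed
  then obtain k c where kc: "\<And>i. i < n \<Longrightarrow> k i < n \<and> \<bar>c i\<bar> = (1::real) \<and> matching_vec 1 i = c i *\<^sub>R v (k i)"
    by metis
  have ip: "matching_vec 1 i \<bullet> matching_vec 1 j = c i * c j * (v (k i) \<bullet> v (k j))" if "i < n" "j < n" for i j
    using kc[OF that(1)] kc[OF that(2)] by simp
  have lt: "0 < n" "1 < n" "2 < n" using n by auto
  have "- 1 = (matching_vec 1 0 \<bullet> matching_vec 1 1) * (matching_vec 1 0 \<bullet> matching_vec 1 2)
      * (matching_vec 1 1 \<bullet> matching_vec 1 2)"
    by (simp add: matching_vec_inner std_edge_def)
  also have "\<dots> = (c 0 * c 1 * c 2)\<^sup>2 *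
      ((v (k 0) \<bullet> v (k 1)) * (v (k 0) \<bullet> v (k 2)) * (v (k 1) \<bullet> v (k 2)))"
    using ip lt by (simp add: power2_eq_square)
  also have "\<dots> \<ge> 0"
    using pos kc lt by (intro mult_nonneg_nonneg zero_le_power2 less_imp_le) auto
  finally show False by simp
qed

text \<open>
  The dimension of the span separates all pairs except \<open>a = 0\<close> and \<open>a = 1\<close>.
\<close>

lemma inj_matching_classes:
  assumes n: "3 \<le> n"
  shows "inj_on (\<lambda>a. switching_class n (matching_lines n a)) {a. 2 * a \<le> n}"
proof -
  have "a = b" if "a \<le> b" "2 * a \<le> n" "2 * b \<le> n"
    "switching_class n (matching_lines n a) = switching_class n (matching_lines n b)" for a b
  proof -
    have "(if a = 0 then n else n + 1 - a) = (if b = 0 then n else n + 1 - b)"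
      using dim_eq_if_switching_class_eq[OF matching_lines_representing matching_lines_representing that(4)]
        dim_matching_lines that by simp
    then have "a = b \<or> (a = 0 \<and> b = 1)" using that by (auto split: if_splits)
    then show ?thesis using matching_lines_zero_one_inequivalent[OF n] that by auto
  qed
  then show ?thesis by (intro inj_onI) (metis (mono_tags, lifting) mem_Collect_eq nle_le)
qed

text \<open>
  By induction on the number of vertices: remove the two ends of an edge and
  put them in front of the enumeration of the rest, which shifts indices by \<open>2\<close>.
\<close>

lemma matching_enumeration:
  assumes "finite V"
    and "\<And>x. x \<in> V \<Longrightarrow> \<not> R x x"
    and "\<And>x y. x \<in> V \<Longrightarrow> y \<in> V \<Longrightarrow> R x y \<Longrightarrow> R y x"
    and "\<And>x y z. x \<in> V \<Longrightarrow> y \<in> V \<Longrightarrow> z \<in> V \<Longrightarrow> R x y \<Longrightarrow> R x z \<Longrightarrow> y = z"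
  shows "\<exists>a xs. distinct xs \<and> set xs = V \<and> 2 * a \<le> length xs \<and>
    (\<forall>i<length xs. \<forall>j<length xs. R (xs ! i) (xs ! j) \<longleftrightarrow> std_edge a i j)"
  using assms
proof (induction "card V" arbitrary: V rule: less_induct)
  case less
  note irr = less.prems(2) and sym = less.prems(3) and uniq = less.prems(4)
  show ?case
  proof (cases "\<exists>x\<in>V. \<exists>y\<in>V. R x y")
    case False
    obtain xs where xs: "distinct xs" "set xs = V" using finite_distinct_list[OF less.prems(1)] by blast
    then have "\<not> R (xs ! i) (xs ! j)" if "i < length xs" "j < length xs" for i j
      using False that by (metis nth_mem)
    then show ?thesis using xs by (intro exI[of _ 0] exI[of _ xs]) (simp add: std_edge_def)
  next
    case True
    then obtain x y where xy: "x \<in> V" "y \<in> V" "R x y" by blast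
    then have ne: "x \<noteq> y" using irr by blast
    let ?V = "V - {x, y}"
    have "card ?V < card V"
      using less.prems(1) xy by (intro psubset_card_mono) auto
    then have "\<exists>a xs. distinct xs \<and> set xs = ?V \<and> 2 * a \<le> length xs \<and>
      (\<forall>i<length xs. \<forall>j<length xs. R (xs ! i) (xs ! j) \<longleftrightarrow> std_edge a i j)"
    proof (rule less.hyps)
      show "finite ?V" using less.prems(1) by simp
      show "\<not> R z z" if "z \<in> ?V" for z using irr that by simp
      show "R w z" if "z \<in> ?V" "w \<in> ?V" "R z w" for z w using sym[of z w] that by simp
      show "w = w'" if "z \<in> ?V" "w \<in> ?V" "w' \<in> ?V" "R z w" "R z w'" for z w w'
        using uniq[of z w w'] that by simp
    qed
    then obtain a xs where IH: "distinct xs" "set xs = ?V" "2 * a \<le> length xs"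
      "\<forall>i<length xs. \<forall>j<length xs. R (xs ! i) (xs ! j) \<longleftrightarrow> std_edge a i j"
      by blast
    let ?ys = "x # y # xs"
    have no: "\<not> R x z" "\<not> R y z" "\<not> R z x" "\<not> R z y" if "z \<in> ?V" for z
    proof -
      have "\<not> R x z" using uniq[of x y z] xy that by blast
      moreover have "\<not> R y z" using uniq[of y x z] sym[of x y] xy that by blast
      ultimately show "\<not> R x z" "\<not> R y z" "\<not> R z x" "\<not> R z y"
        using sym[of z x] sym[of z y] xy that by blast+
    qed
    have "R (?ys ! i) (?ys ! j) \<longleftrightarrow> std_edge (Suc a) i j"
      if ij: "i < length ?ys" "j < length ?ys" for i j
    proof -
      have inV: "xs ! k \<in> ?V" if "Suc (Suc k) < length ?ys" for k
        using that IH(2) by (metis length_Cons nth_mem Suc_less_eq)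
      consider "i = 0" | "i = 1" | k where "i = Suc (Suc k)" by (metis One_nat_def not0_implies_Suc)
      note ci = this
      consider "j = 0" | "j = 1" | k where "j = Suc (Suc k)" by (metis One_nat_def not0_implies_Suc)
      then show ?thesis
        using ci ij xy irr[of x] irr[of y] sym[of x y] no inV IH(4)
        by cases (cases rule: ci; force simp: std_edge_def)+
    qed
    moreover have "distinct ?ys" "set ?ys = V" "2 * Suc a \<le> length ?ys"
      using IH ne xy by auto
    ultimately show ?thesis by blast
  qed
qed


section \<open>Classification of line sets\<close>

definition norm3_vectors :: "nat \<Rightarrow> (nat \<Rightarrow> 'a::real_inner) \<Rightarrow> 'a set"
  where "norm3_vectors n v = v ` {..<n} \<union> (\<lambda>i. - v i) ` {..<n}"

lemma norm3_system_norm3_vectors: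
  assumes v: "representing n v U"
  shows "norm3_system (norm3_vectors n v)"
proof -
  have vv: "v i \<bullet> v j \<in> {3, 1, -1}" if "i < n" "j < n" for i j
    using representing_inner[OF v that] by (cases "i = j") auto
  have "- x \<in> norm3_vectors n v \<and> x \<bullet> x = 3" if "x \<in> norm3_vectors n v" for x
    using that representing_inner(1)[OF v] by (auto simp: norm3_vectors_def)
  moreover have "x \<bullet> y \<in> {3, 1, -1, -3}"
    if xy: "x \<in> norm3_vectors n v" "y \<in> norm3_vectors n v" for x y
  proof -
    obtain i j where ij: "i < n" "j < n" "x = v i \<or> x = - v i" "y = v j \<or> y = - v j"
      using xy by (auto simp: norm3_vectors_def)
    then show ?thesis using vv[OF ij(1,2)] by auto
  qed
  ultimately show ?thesis unfolding norm3_system_def by blast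
qed

lemma span_minus_singleton: "span {- x} = span {x::'a::real_vector}"
  by (metis (no_types, lifting) empty_subsetI insert_subset minus_minus span_base span_eq span_neg singletonI)

text \<open>
  Enumerating the representatives as in \<open>matching_enumeration\<close> yields a representing family
  with the sign pattern of the standard configuration.
\<close>

lemma matching_section_switching_class:
  assumes v: "representing n v U" and V: "matching_section (norm3_vectors n v) V"
  shows "\<exists>a. 2 * a \<le> n \<and> switching_class n U = switching_class n (matching_lines n a)"
proof -
  note V' = V[unfolded matching_section_def]
  have sub: "V \<subseteq> norm3_vectors n v"
    and cov: "\<forall>x\<in>norm3_vectors n v. x \<in> V \<or> - x \<in> V"
    and ip: "\<forall>x\<in>V. \<forall>y\<in>V. x \<noteq> y \<longrightarrow> \<bar>x \<bullet> y\<bar> = 1"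
    and mat: "\<forall>x\<in>V. \<forall>y\<in>V. \<forall>z\<in>V. x \<bullet> y = -1 \<longrightarrow> x \<bullet> z = -1 \<longrightarrow> y = z"
    using V'[THEN conjunct1] V'[THEN conjunct2, THEN conjunct1]
      V'[THEN conjunct2, THEN conjunct2, THEN conjunct1]
      V'[THEN conjunct2, THEN conjunct2, THEN conjunct2] by this
  have nrm: "x \<bullet> x = 3" if "x \<in> V" for x
    using norm3_system_norm3_vectors[OF v] sub that by (auto simp: norm3_system_def)
  have "finite V" using sub by (rule finite_subset) (simp add: norm3_vectors_def)
  then obtain a xs where xs: "distinct xs" "set xs = V" "2 * a \<le> length xs"
    "\<forall>i<length xs. \<forall>j<length xs. xs ! i \<bullet> xs ! j = -1 \<longleftrightarrow> std_edge a i j"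
  proof -
    have "\<exists>a xs. distinct xs \<and> set xs = V \<and> 2 * a \<le> length xs \<and>
      (\<forall>i<length xs. \<forall>j<length xs. xs ! i \<bullet> xs ! j = -1 \<longleftrightarrow> std_edge a i j)"
    proof (rule matching_enumeration)
      show "finite V" by fact
      show "x \<bullet> x \<noteq> -1" if "x \<in> V" for x using nrm[OF that] by simp
      show "y \<bullet> x = -1" if "x \<bullet> y = -1" for x y using that by (simp add: inner_commute)
      show "y = z" if "x \<in> V" "y \<in> V" "z \<in> V" "x \<bullet> y = -1" "x \<bullet> z = -1" for x y z
        using mat[rule_format, OF that] .
    qed
    then show thesis using that by blast
  qed
  have "U = (\<lambda>x. span {x}) ` V"
  proof (intro equalityI subsetI)
    fix l assume "l \<in> U"
    then obtain i where "i < n" "l = span {v i}" using v by (auto simp: representing_def)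
    moreover from this have "v i \<in> V \<or> - v i \<in> V"
      using cov by (auto simp: norm3_vectors_def)
    ultimately show "l \<in> (\<lambda>x. span {x}) ` V"
      using span_minus_singleton[of "v i"] by (metis image_eqI)
  next
    fix l assume "l \<in> (\<lambda>x. span {x}) ` V"
    then obtain x where x: "x \<in> V" "l = span {x}" by blast
    then obtain i where "i < n" "x = v i \<or> x = - v i" using sub by (auto simp: norm3_vectors_def)
    then show "l \<in> U" using v x(2) span_minus_singleton[of "v i"] by (auto simp: representing_def)
  qed
  also have "\<dots> = (\<lambda>i. span {xs ! i}) ` {..<length xs}"
    unfolding xs(2)[symmetric] by (auto simp: set_conv_nth)
  finally have Ux: "U = (\<lambda>i. span {xs ! i}) ` {..<length xs}" .
  have ipx: "\<bar>xs ! i \<bullet> xs ! j\<bar> = 1" if "i < length xs" "j < length xs" "i \<noteq> j" for i j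
    using ip[rule_format, of "xs ! i" "xs ! j"] that xs(1,2) by (auto simp: nth_eq_iff_index_eq)
  have nx: "xs ! i \<bullet> xs ! i = 3" if "i < length xs" for i
    using nrm that xs(2) nth_mem by blast
  have r: "representing (length xs) (\<lambda>i. xs ! i) U"
    unfolding representing_def using Ux ipx nx by blast
  have n: "length xs = n"
    using representing_card[OF r] representing_card[OF v] by simp
  have "(i, j) \<in> sign_pattern n (\<lambda>i. xs ! i) \<longleftrightarrow> (i, j) \<in> matching_pattern n a" for i j
  proof (cases "i < n \<and> j < n")
    case True
    then have "xs ! i \<bullet> xs ! j = -1 \<longleftrightarrow> std_edge a i j" using xs(4) n by blast
    moreover have "xs ! i \<bullet> xs ! j = 3 \<or> \<bar>xs ! i \<bullet> xs ! j\<bar> = 1"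
      using nx ipx True n by (cases "i = j") auto
    ultimately show ?thesis
      using True by (auto simp: sign_pattern_def matching_pattern_def)
  qed (auto simp: sign_pattern_def matching_pattern_def)
  then have "sign_pattern n (\<lambda>i. xs ! i) = matching_pattern n a" by (auto simp: set_eq_iff)
  then have "matching_pattern n a \<in> switching_class n U"
    using r n unfolding switching_class_def by blast
  then have "lines_equiv U (matching_lines n a)"
    using matching_pattern_in_switching_class[of n a] by (intro switching_class_overlap[of n]) blast
  then have "switching_class n U = switching_class n (matching_lines n a)"
    using lines_equiv_iff_switching_class[OF v matching_lines_representing] by blast
  then show ?thesis using xs(3) n by blast
qed

text \<open>
  The geometric alternative, restated for line sets: the set \<open>F\<close> of the bound on
  \<open>small_system\<close> meets every line, so its size bounds the number of lines.
\<close>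

theorem matching_or_small:
  assumes v: "representing n v U"
  shows "(\<exists>a. 2 * a \<le> n \<and> switching_class n U = switching_class n (matching_lines n a)) \<or>
    (dim (span (\<Union>U)) \<le> 7 \<and> n \<le> 28)"
proof (cases "\<exists>V. matching_section (norm3_vectors n v) V")
  case True
  then show ?thesis using matching_section_switching_class[OF v] by blast
next
  case False
  let ?W = "norm3_vectors n v"
  have "small_system ?W"
    using norm3_system_matching_or_small[OF norm3_system_norm3_vectors[OF v]] False by blast
  then obtain B F where B: "finite B" "card B \<le> 7" "?W \<subseteq> span B"
    and F: "finite F" "card F \<le> 28" "\<And>x. x \<in> ?W \<Longrightarrow> x \<in> F \<or> - x \<in> F"
    unfolding small_system_def by blast
  have "v ` {..<n} \<subseteq> span B" using B(3) by (auto simp: norm3_vectors_def)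
  then have "dim (v ` {..<n}) \<le> card B" using B(1) by (rule dim_le_card)
  then have "dim (span (\<Union>U)) \<le> 7" using B(2) representing_span[OF v] by simp
  moreover have "U \<subseteq> (\<lambda>x. span {x}) ` F"
  proof
    fix l assume "l \<in> U"
    then obtain i where i: "i < n" "l = span {v i}" using v by (auto simp: representing_def)
    moreover from this have "v i \<in> F \<or> - v i \<in> F"
      using F(3) by (auto simp: norm3_vectors_def)
    ultimately show "l \<in> (\<lambda>x. span {x}) ` F"
      using span_minus_singleton[of "v i"] by (metis image_eqI)
  qed
  then have "card U \<le> card F" using F(1) by (meson card_image_le card_mono finite_imageI order_trans)
  then have "n \<le> 28" using F(2) representing_card[OF v] by simp
  ultimately show ?thesis by blast
qed


section \<open>Counting switching classes\<close>

lemma num_classes_empty: "num_classes {} = 0"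
  by (simp add: num_classes_def quotient_def)

lemma s_num_split:
  "s_num n = num_classes {U \<in> (\<Union>d. line_sets d n). P (dim (span (\<Union>U)))} +
    num_classes {U \<in> (\<Union>d. line_sets d n). \<not> P (dim (span (\<Union>U)))}"
proof -
  let ?X = "\<Union>d. line_sets d n" and ?h = "switching_class n"
  let ?A = "{U \<in> ?X. P (dim (span (\<Union>U)))}" and ?B = "{U \<in> ?X. \<not> P (dim (span (\<Union>U)))}"
  have rep: "\<exists>v. representing n v U" if "U \<in> ?X" for U using that unfolding Union_line_sets by blast
  have "?h ` ?A \<inter> ?h ` ?B = {}"
  proof (rule ccontr)
    assume "?h ` ?A \<inter> ?h ` ?B \<noteq> {}"
    then obtain U U' where U: "U \<in> ?A" "U' \<in> ?B" "?h U = ?h U'" by blast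
    then obtain v v' where "representing n v U" "representing n v' U'"
      using rep[of U] rep[of U'] by blast
    then have "dim (span (\<Union>U)) = dim (span (\<Union>U'))"
      using U(3) by (rule dim_eq_if_switching_class_eq)
    then show False using U(1,2) by simp
  qed
  moreover have "?h ` ?X = ?h ` ?A \<union> ?h ` ?B" by blast
  ultimately have "card (?h ` ?X) = card (?h ` ?A) + card (?h ` ?B)"
    by (simp add: card_Un_disjoint finite_switching_classes)
  moreover have "num_classes ?X = card (?h ` ?X)" "num_classes ?A = card (?h ` ?A)"
    "num_classes ?B = card (?h ` ?B)"
    by (rule num_classes_eq_card_switching_classes; use rep in blast)+
  ultimately show ?thesis unfolding s_num_def by simp
qed

text \<open>
  A condition that only admits dimensions above \<open>7\<close> excludes the small line sets, so
  only the standard configurations have to be counted, each by its number of edges.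
\<close>

lemma num_classes_large_dim:
  assumes n: "3 \<le> n" and P: "\<And>k. P k \<Longrightarrow> 7 < k"
  shows "num_classes {U \<in> (\<Union>d. line_sets d n). P (dim (span (\<Union>U)))} =
    card {a. 2 * a \<le> n \<and> P (if a = 0 then n else n + 1 - a)}"
proof -
  let ?X = "{U \<in> (\<Union>d. line_sets d n). P (dim (span (\<Union>U)))}" and ?h = "switching_class n"
  let ?A = "{a. 2 * a \<le> n \<and> P (if a = 0 then n else n + 1 - a)}"
  let ?m = "\<lambda>a. ?h (matching_lines n a)"
  have rep: "\<exists>v. representing n v U" if "U \<in> ?X" for U using that unfolding Union_line_sets by blast
  have "?h ` ?X = ?m ` ?A"
  proof (intro equalityI subsetI)
    fix c assume "c \<in> ?h ` ?X"
    then obtain U where U: "U \<in> ?X" "c = ?h U" by blast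
    obtain v where v: "representing n v U" using rep[OF U(1)] by blast
    have "7 < dim (span (\<Union>U))" using U(1) P by blast
    then obtain a where a: "2 * a \<le> n" "?h U = ?m a"
      using matching_or_small[OF v] by auto
    have "dim (span (\<Union>U)) = (if a = 0 then n else n + 1 - a)"
      using dim_eq_if_switching_class_eq[OF v matching_lines_representing a(2)] dim_matching_lines[OF a(1)]
      by simp
    then have "a \<in> ?A" using U(1) a(1) by simp
    then show "c \<in> ?m ` ?A" using U(2) a(2) by blast
  next
    fix c assume "c \<in> ?m ` ?A"
    then obtain a where a: "a \<in> ?A" "c = ?m a" by blast
    have "matching_lines n a \<in> ?X"
      using a(1) dim_matching_lines[of a n] matching_lines_representing unfolding Union_line_sets by auto
    then show "c \<in> ?h ` ?X" using a(2) by blast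
  qed
  moreover have "card (?m ` ?A) = card ?A"
    by (rule card_image, rule inj_on_subset[OF inj_matching_classes[OF n]]) blast
  moreover have "num_classes ?X = card (?h ` ?X)"
    using rep by (rule num_classes_eq_card_switching_classes)
  ultimately show ?thesis by simp
qed

lemma omega_num_eq:
  "omega_num n = num_classes {U \<in> (\<Union>d. line_sets d n). dim (span (\<Union>U)) \<le> 7}"
proof -
  have rep: "\<exists>v. representing n v U" if "U \<in> (\<Union>d. line_sets d n)" for U
    using that unfolding Union_line_sets by blast
  have "num_classes (line_sets 7 n) = card (switching_class n ` line_sets 7 n)"
    by (rule num_classes_eq_card_switching_classes) (use rep in blast)
  moreover have "num_classes {U \<in> (\<Union>d. line_sets d n). dim (span (\<Union>U)) \<le> 7} =
      card (switching_class n ` {U \<in> (\<Union>d. line_sets d n). dim (span (\<Union>U)) \<le> 7})"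
    by (rule num_classes_eq_card_switching_classes) (use rep in blast)
  ultimately show ?thesis unfolding omega_num_def switching_classes_line_sets by simp
qed

text \<open>
  With more than \<open>28\<close> lines only matching configurations are left, and at most \<open>n div 2\<close> edges leave
  a dimension of at least \<open>n + 1 - n div 2\<close>, which exceeds \<open>7\<close>.
\<close>

lemma omega_num_eq_0:
  assumes "29 \<le> n"
  shows "omega_num n = 0"
proof -
  have "7 < dim (span (\<Union>U))" if U: "U \<in> (\<Union>d. line_sets d n)" for U
  proof -
    obtain v where v: "representing n v U" using U unfolding Union_line_sets by blast
    then obtain a where a: "2 * a \<le> n" "switching_class n U = switching_class n (matching_lines n a)"
      using matching_or_small[OF v] assms by auto
    have "dim (span (\<Union>U)) = (if a = 0 then n else n + 1 - a)"
      using dim_eq_if_switching_class_eq[OF v matching_lines_representing a(2)] dim_matching_lines[OF a(1)]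
      by simp
    then show ?thesis using a(1) assms by (auto split: if_splits)
  qed
  then have "{U \<in> (\<Union>d. line_sets d n). dim (span (\<Union>U)) \<le> 7} = {}" by fastforce
  then show ?thesis unfolding omega_num_eq by (simp only: num_classes_empty)
qed

lemma s_num_eq_omega_num:
  "s_num n = omega_num n + num_classes {U \<in> (\<Union>d. line_sets d n). 7 < dim (span (\<Union>U))}"
  using s_num_split[of n "\<lambda>k. k \<le> 7"] by (simp add: omega_num_eq not_le)

theorem corollary1p1:
  fixes n :: nat
  shows "(n \<ge> 8 \<longrightarrow> s_num n = t_num n + 2) \<and>
    s_num n =
      (if n \<le> 7 then omega_num n
       else if n \<le> 12 then omega_num n + (n - 6)
       else if n \<le> 28 then omega_num n + n div 2 + 1
       else n div 2 + 1)"
proof (intro conjI impI)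
  assume n: "8 \<le> n"
  have "s_num n = t_num n + num_classes {U \<in> (\<Union>d. line_sets d n). \<not> dim (span (\<Union>U)) < n}"
    using s_num_split[of n "\<lambda>k. k < n"] by (simp add: t_num_def)
  also have "num_classes {U \<in> (\<Union>d. line_sets d n). \<not> dim (span (\<Union>U)) < n} =
      card {a. 2 * a \<le> n \<and> \<not> (if a = 0 then n else n + 1 - a) < n}"
    by (rule num_classes_large_dim) (use n in auto)
  also have "{a. 2 * a \<le> n \<and> \<not> (if a = 0 then n else n + 1 - a) < n} = {0, 1}"
    using n by (auto split: if_splits)
  finally show "s_num n = t_num n + 2" by simp
next
  \<comment> \<open>The dimension condition amounts to \<open>a = 0\<close> or \<open>a + 7 \<le> n\<close>. The bound \<open>n - 7\<close> is the smaller one up to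
      \<open>n = 12\<close>, and from \<open>n = 13\<close> on it is \<open>n div 2\<close>.\<close>
  have large: "num_classes {U \<in> (\<Union>d. line_sets d n). 7 < dim (span (\<Union>U))} = Suc (min (n div 2) (n - 7))"
    if n: "8 \<le> n"
  proof -
    have "num_classes {U \<in> (\<Union>d. line_sets d n). 7 < dim (span (\<Union>U))} =
        card {a. 2 * a \<le> n \<and> 7 < (if a = 0 then n else n + 1 - a)}"
      by (rule num_classes_large_dim) (use n in auto)
    also have "{a. 2 * a \<le> n \<and> 7 < (if a = 0 then n else n + 1 - a)} = {..min (n div 2) (n - 7)}"
      using n by (auto split: if_splits)
    finally show ?thesis by simp
  qed
  have small: "num_classes {U \<in> (\<Union>d. line_sets d n). 7 < dim (span (\<Union>U))} = 0" if n: "n \<le> 7"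
  proof -
    have "dim (span (\<Union>U)) \<le> 7" if U: "U \<in> (\<Union>d. line_sets d n)" for U
    proof -
      obtain v where v: "representing n v U" using U unfolding Union_line_sets by blast
      have "dim (span (\<Union>U)) \<le> n"
        using dim_le_card'[of "v ` {..<n}"] card_image_le[of "{..<n}" v] representing_span[OF v] by simp
      then show ?thesis using n by simp
    qed
    then have "{U \<in> (\<Union>d. line_sets d n). 7 < dim (span (\<Union>U))} = {}" by fastforce
    then show ?thesis by (simp only: num_classes_empty)
  qed
  show "s_num n =
      (if n \<le> 7 then omega_num n
       else if n \<le> 12 then omega_num n + (n - 6)
       else if n \<le> 28 then omega_num n + n div 2 + 1
       else n div 2 + 1)"
    using s_num_eq_omega_num[of n] large small omega_num_eq_0[of n] by (auto simp: min_def)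
qed

end
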